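(* There exist constants $K_+,K_->0$ such that, for each $\xi\in\mathbb T^2$ at which the unstable, respectively stable, direction is defined, $$E^u(\xi)\in\mathcal C_*(\xi),\qquad E^s(\xi)\in\mathcal C_*^-(\xi),$$ where for $\xi=(x,y)$ $$\mathcal C_*(\xi)=\{(1,u)\in\mathbb R^2: K_-(|x|+\sqrt{|y|})\le u\le K_+(|x|+\sqrt{|y|})\},$$ $\mathcal C^-_*(\xi)=D_{\Pi\xi}\Pi\,\mathcal C_*(\Pi\xi)$ with $\Pi(x,y)=(x,-y-h(x))$, and a line belongs to one of these sets if it is spanned by a vector in the set.
   Context: Let $\mathbb T^1=\mathbb R/\mathbb Z$, $\mathbb T^2=\mathbb T^1\times\mathbb T^1$ (coordinates represented in $(-1/2,1/2]$, so $|x|,|y|$ are distances to $0$ in $\mathbb T^1$), and let $m$ be Lebesgue measure on $\mathbb T^2$. Let $h\in C^\infty(\mathbb T^1,\mathbb T^1)$ satisfy: (1) $h(0)=0$; (2) $h'(0)=0$; (3) $h'(x)>0$ for each $x\ne 0$; (4) $h'''(0)>0$; (5) $h(-x)=-h(x)$. Define $T:\mathbb T^2\to\mathbb T^2$ by $T(x,y)=(x+h(x)+y,\ h(x)+y) \bmod 1$, an $m$-preserving diffeomorphism. The map $\Pi$ is an involution with $\Pi T\Pi=T^{-1}$. At $m$-a.e. $\xi$, $T$ has one positive and one negative Lyapunov exponent; $E^u(\xi)$ and $E^s(\xi)$ denote the corresponding one-dimensional Oseledets subspaces (unstable and stable directions). *)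

theory Defs
  imports "HOL-Analysis.Analysis"
begin

section \<open>The circle \<open>\<real>/\<int>\<close> and the two-torus\<close>

quotient_type circle = real / "\<lambda>x y. x - y \<in> \<int>"
proof (rule equivpI)
  show "reflp (\<lambda>x y :: real. x - y \<in> \<int>)"
    by (simp add: reflp_def)
  show "symp (\<lambda>x y :: real. x - y \<in> \<int>)"
  proof (rule sympI)
    fix a b :: real
    assume "a - b \<in> \<int>"
    from Ints_minus[OF this] show "b - a \<in> \<int>"
      by simp
  qed
  show "transp (\<lambda>x y :: real. x - y \<in> \<int>)"
  proof (rule transpI)
    fix a b c :: real
    assume "a - b \<in> \<int>" "b - c \<in> \<int>"
    from Ints_add[OF this] show "a - c \<in> \<int>"
      by simp
  qed
qed

instantiation circle :: ab_group_add
begin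

lift_definition zero_circle :: circle is 0 .

lift_definition plus_circle :: "circle \<Rightarrow> circle \<Rightarrow> circle" is "(+)"
proof -
  fix a b c d :: real
  assume "a - b \<in> \<int>" "c - d \<in> \<int>"
  from Ints_add[OF this] show "a + c - (b + d) \<in> \<int>"
    by (simp add: algebra_simps)
qed

lift_definition minus_circle :: "circle \<Rightarrow> circle \<Rightarrow> circle" is "(-)"
proof -
  fix a b c d :: real
  assume "a - b \<in> \<int>" "c - d \<in> \<int>"
  from Ints_diff[OF this] show "a - c - (b - d) \<in> \<int>"
    by (simp add: algebra_simps)
qed

lift_definition uminus_circle :: "circle \<Rightarrow> circle" is uminus
proof -
  fix a b :: real
  assume "a - b \<in> \<int>"
  from Ints_minus[OF this] show "- a - - b \<in> \<int>"
    by simp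
qed

instance
  by standard (transfer; simp)+

end

lift_definition proj :: "real \<Rightarrow> circle" is "\<lambda>x. x" .

definition coord :: "circle \<Rightarrow> real" where
  "coord a = (THE x. - 1/2 < x \<and> x \<le> 1/2 \<and> proj x = a)"

type_synonym torus = "circle \<times> circle"

definition torus_proj :: "real \<times> real \<Rightarrow> torus" where
  "torus_proj = map_prod proj proj"


section \<open>Derivatives of maps of the circle and of the torus\<close>

definition smooth_lift :: "(real \<Rightarrow> real) \<Rightarrow> (circle \<Rightarrow> circle) \<Rightarrow> bool" where
  "smooth_lift H h \<longleftrightarrow>
     (\<forall>x. h (proj x) = proj (H x)) \<and> (\<forall>k x. (deriv ^^ k) H differentiable (at x))"

definition circle_smooth :: "(circle \<Rightarrow> circle) \<Rightarrow> bool" where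
  "circle_smooth h \<longleftrightarrow> (\<exists>H. smooth_lift H h)"

text \<open>
  Two continuous lifts of \<open>h\<close> differ by an integer constant, and \<open>H (x + 1) - H x\<close> is an integer
  independent of \<open>x\<close>. So for \<open>k \<ge> 1\<close> and smooth \<open>h\<close> the following depends neither on
  the choice of the lift nor on that of the representative of the point.
\<close>
definition circle_deriv :: "nat \<Rightarrow> (circle \<Rightarrow> circle) \<Rightarrow> circle \<Rightarrow> real" where
  "circle_deriv k h a = (deriv ^^ k) (SOME H. smooth_lift H h) (coord a)"

text \<open>
  The tangent space of the torus at every point is identified with \<open>\<real>\<^sup>2\<close>, and differentiability
  is tested on a local lift \<open>G\<close>. Two such lifts, at the same or at different representatives of
  \<open>\<xi>\<close>, differ near the point by integer translations, so that the derivative is unique.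
\<close>
definition has_torus_derivative ::
    "(torus \<Rightarrow> torus) \<Rightarrow> (real \<times> real \<Rightarrow> real \<times> real) \<Rightarrow> torus \<Rightarrow> bool" where
  "has_torus_derivative F A \<xi> \<longleftrightarrow>
     (\<exists>z G. torus_proj z = \<xi> \<and>
        (\<forall>\<^sub>F w in nhds z. F (torus_proj w) = torus_proj (G w)) \<and>
        (G has_derivative A) (at z))"

definition torus_deriv :: "(torus \<Rightarrow> torus) \<Rightarrow> torus \<Rightarrow> real \<times> real \<Rightarrow> real \<times> real" where
  "torus_deriv F \<xi> = (THE A. has_torus_derivative F A \<xi>)"


section \<open>Lyapunov exponents and Oseledets subspaces\<close>

text \<open>
  \<open>log \<parallel>D\<^sub>\<xi>T\<^sup>n v\<parallel> / n \<rightarrow> \<kappa>\<close> both as \<open>n \<rightarrow> \<infinity>\<close> and as \<open>n \<rightarrow> -\<infinity>\<close>; the second limit is written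
  with \<open>n\<close> replaced by \<open>-n\<close>, hence the sign.
\<close>
definition has_lyapunov_exponent ::
    "(torus \<Rightarrow> torus) \<Rightarrow> torus \<Rightarrow> real \<times> real \<Rightarrow> real \<Rightarrow> bool" where
  "has_lyapunov_exponent T \<xi> v \<kappa> \<longleftrightarrow> v \<noteq> 0 \<and>
     (\<lambda>n. ln (norm (torus_deriv (T ^^ n) \<xi> v)) / real n) \<longlonglongrightarrow> \<kappa> \<and>
     (\<lambda>n. ln (norm (torus_deriv (inv T ^^ n) \<xi> v)) / real n) \<longlonglongrightarrow> - \<kappa>"

definition oseledets_space :: "(torus \<Rightarrow> torus) \<Rightarrow> torus \<Rightarrow> real \<Rightarrow> (real \<times> real) set" where
  "oseledets_space T \<xi> \<kappa> = insert 0 {v. has_lyapunov_exponent T \<xi> v \<kappa>}"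

text \<open>
  "\<open>E\<^sup>u(\<xi>)\<close> is defined and equal to \<open>E\<close>", and likewise for \<open>E\<^sup>s(\<xi>)\<close>. Each direction is
  considered on its own; in particular the points where both exist, i.e. where the Oseledets
  splitting exists, are covered.
\<close>
definition is_unstable_direction ::
    "(torus \<Rightarrow> torus) \<Rightarrow> torus \<Rightarrow> (real \<times> real) set \<Rightarrow> bool" where
  "is_unstable_direction T \<xi> E \<longleftrightarrow>
     (\<exists>\<kappa>>0. E = oseledets_space T \<xi> \<kappa> \<and> subspace E \<and> dim E = 1)"

definition is_stable_direction ::
    "(torus \<Rightarrow> torus) \<Rightarrow> torus \<Rightarrow> (real \<times> real) set \<Rightarrow> bool" where
  "is_stable_direction T \<xi> E \<longleftrightarrow>
     (\<exists>\<kappa><0. E = oseledets_space T \<xi> \<kappa> \<and> subspace E \<and> dim E = 1)"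


section \<open>The map, the involution and the cone fields\<close>

definition T_map :: "(circle \<Rightarrow> circle) \<Rightarrow> torus \<Rightarrow> torus" where
  "T_map h = (\<lambda>(x, y). (x + h x + y, h x + y))"

definition Pi_map :: "(circle \<Rightarrow> circle) \<Rightarrow> torus \<Rightarrow> torus" where
  "Pi_map h = (\<lambda>(x, y). (x, - y - h x))"

definition cone_plus :: "real \<Rightarrow> real \<Rightarrow> torus \<Rightarrow> (real \<times> real) set" where
  "cone_plus Kminus Kplus = (\<lambda>(x, y).
     {(1, u) | u. Kminus * (\<bar>coord x\<bar> + sqrt \<bar>coord y\<bar>) \<le> u \<and>
                  u \<le> Kplus * (\<bar>coord x\<bar> + sqrt \<bar>coord y\<bar>)})"

definition cone_minus ::
    "(circle \<Rightarrow> circle) \<Rightarrow> real \<Rightarrow> real \<Rightarrow> torus \<Rightarrow> (real \<times> real) set" where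
  "cone_minus h Kminus Kplus \<xi> =
     torus_deriv (Pi_map h) (Pi_map h \<xi>) ` cone_plus Kminus Kplus (Pi_map h \<xi>)"

definition line_belongs :: "(real \<times> real) set \<Rightarrow> (real \<times> real) set \<Rightarrow> bool" where
  "line_belongs E C \<longleftrightarrow> (\<exists>v\<in>C. E = span {v})"

end

theory Submission
  imports Defs
begin

text \<open>
  A vector contracted along the backward orbit has its whole backward orbit in the positive
  quadrant: the product of the components is a quadratic form that is nondecreasing under \<open>DT\<close> and
  tends to \<open>0\<close> in the past. Its slopes therefore satisfy
  \<open>w\<^sub>k = (p\<^sub>k\<^sub>+\<^sub>1 + w\<^sub>k\<^sub>+\<^sub>1) / (1 + p\<^sub>k\<^sub>+\<^sub>1 + w\<^sub>k\<^sub>+\<^sub>1)\<close> with \<open>w \<ge> 0\<close>, where \<open>k\<close> counts steps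
  backwards and \<open>p\<^sub>k = h'(x\<^sub>-\<^sub>k)\<close>.
  Put \<open>\<rho> = |x| + sqrt |y|\<close>. Since \<open>h(x) = O(|x|\<^sup>3)\<close> and \<open>h'(x)\<close> is comparable to \<open>x\<^sup>2\<close>, for small \<open>\<rho>\<close>
  the last \<open>\<tau> / \<rho>\<close> backward steps remain at the scale \<open>|x| = O(\<rho>)\<close>, \<open>|y| = O(\<rho>\<^sup>2)\<close>, so that
  \<open>p = O(\<rho>\<^sup>2)\<close>, and a fixed fraction of them has \<open>|x| \<ge> \<delta> \<rho>\<close>, either because \<open>|x|\<close> is already
  comparable to \<open>\<rho>\<close> or because \<open>y\<close>, of order \<open>\<rho>\<^sup>2\<close>, makes \<open>x\<close> drift away from \<open>0\<close>.
  After \<open>1 / \<rho>\<close> steps the recursion, which is close to \<open>w' = p - w\<^sup>2\<close>, has forgotten its initial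
  value and \<open>w\<close> is comparable to \<open>\<rho>\<close>. For large \<open>\<rho>\<close> one of the last two points is far from
  \<open>x = 0\<close>. The involution reduces stable directions to unstable ones.
\<close>

section \<open>The Riccati recursion for slopes\<close>

text \<open>One step is \<open>s / (1 + s)\<close> with \<open>s = p + w\<close>, an increasing
  function of \<open>s\<close>. Every comparison of slopes below rests on this.\<close>

lemma riccati_mono:
  fixes p q u w :: real
  assumes "0 \<le> q" "q \<le> p" "0 \<le> u" "u \<le> w"
  shows "(q + u) / (1 + q + u) \<le> (p + w) / (1 + p + w)"
proof -
  have "(q + u) * (1 + p + w) \<le> (p + w) * (1 + q + u)"
    using assms by (simp add: algebra_simps)
  then show ?thesis
    using assms by (simp add: divide_simps)
qed

locale riccati =
  fixes p w :: "nat \<Rightarrow> real"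
  assumes p_nonneg: "0 \<le> p k"
    and w_nonneg: "0 \<le> w k"
    and w_step: "w k = (p (Suc k) + w (Suc k)) / (1 + p (Suc k) + w (Suc k))"
begin

lemma w_le_1: "w k \<le> 1"
  using p_nonneg[of "Suc k"] w_nonneg[of "Suc k"] by (subst w_step) (simp add: divide_simps)

text \<open>Going from time \<open>N\<close> towards \<open>0\<close>, a value above the level
  \<tau> satisfies \<open>p \<le> w\<^sup>2 / 2\<close>, so at least half of the quadratic damping
  survives and \<open>w\<close> decays like \<open>2 / j\<close> whatever its initial value. Here
  \<tau> is a free parameter, later taken of order \<rho>.\<close>

lemma w_upper:
  assumes p: "\<And>j. 1 \<le> j \<Longrightarrow> j \<le> N \<Longrightarrow> p j \<le> \<tau>\<^sup>2 / 2"
    and "0 \<le> \<tau>"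
  shows "w 0 \<le> \<tau> \<or> w 0 * real N \<le> 2"
proof -
  have "w (N - j) \<le> \<tau> \<or> w (N - j) * real j \<le> 2" if "j \<le> N" for j
    using that
  proof (induction j)
    case 0
    then show ?case by simp
  next
    case (Suc j)
    define k where "k = N - Suc j"
    have k: "N - j = Suc k" "1 \<le> Suc k" "Suc k \<le> N"
      using Suc.prems by (auto simp: k_def)
    let ?p = "p (Suc k)" and ?u = "w (Suc k)"
    have pk: "?p \<le> \<tau>\<^sup>2 / 2" "0 \<le> ?p" "0 \<le> ?u"
      using p k p_nonneg w_nonneg by auto
    have IH: "?u \<le> \<tau> \<or> ?u * real j \<le> 2"
      using Suc by (simp add: k)
    have "w k \<le> \<tau> \<or> w k * real (Suc j) \<le> 2"
    proof (cases "?u \<le> \<tau>")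
      case True
      have "w k \<le> (?p + \<tau>) / (1 + ?p + \<tau>)"
        unfolding w_step[of k] using riccati_mono[of ?p ?p ?u \<tau>] pk True by simp
      \<comment> \<open>The level \<tau> is a barrier: after clearing the denominator the claim is
        \<open>p \<le> \<tau>\<^sup>2 + \<tau> * p\<close>.\<close>
      also have "\<dots> \<le> \<tau>"
      proof -
        have "?p \<le> \<tau>\<^sup>2 + \<tau> * ?p"
          using pk assms(2) mult_nonneg_nonneg[of \<tau> ?p] by linarith
        then show ?thesis
          using pk assms(2) by (simp add: divide_simps) (simp add: algebra_simps power2_eq_square)
      qed
      finally show ?thesis by simp
    next
      case False
      then have u: "?u * real j \<le> 2" and "\<tau>\<^sup>2 \<le> ?u\<^sup>2"
        using IH assms(2) by (auto intro: power_mono)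
      then have pu: "?p \<le> ?u\<^sup>2 / 2"
        using pk by linarith
      \<comment> \<open>This is \<open>w k * real (Suc j) \<le> 2\<close> with the denominator
        cleared. The case \<open>j = 0\<close> is separate because the factor
        \<open>real j - 1\<close> is then negative.\<close>
      have "(real j - 1) * (?p + ?u) \<le> 2"
      proof (cases "j = 0")
        case True
        then show ?thesis using pk by simp
      next
        case False
        then have "(real j - 1) * (?p + ?u) \<le> (real j - 1) * (?u\<^sup>2 / 2 + ?u)"
          using pu by (intro mult_left_mono) auto
        also have "\<dots> = (?u * real j) * (1 + ?u / 2) - ?u - ?u\<^sup>2 / 2"
          by (simp add: field_simps power2_eq_square)
        also have "\<dots> \<le> 2 * (1 + ?u / 2) - ?u - ?u\<^sup>2 / 2"
          using mult_right_mono[OF u, of "1 + ?u / 2"] pk by simp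
        also have "\<dots> \<le> 2"
          by simp
        finally show ?thesis .
      qed
      then have "(?p + ?u) * (1 + real j) \<le> 2 * (1 + ?p + ?u)"
        by (simp add: algebra_simps)
      then show ?thesis
        unfolding w_step[of k] using pk by (simp add: divide_simps)
    qed
    then show ?case by (simp add: k_def)
  qed
  from this[of N] show ?thesis by simp
qed

text \<open>Each step gains \<open>q\<close> and loses at most \<open>q / 2\<close> as long as the
  accumulated amount stays of order \<open>sqrt q\<close>; the hypothesis \<open>small\<close>
  guarantees this up to the end of the window.\<close>

lemma w_lower_window:
  assumes p: "\<And>j. k < j \<Longrightarrow> j \<le> k + N \<Longrightarrow> q \<le> p j"
    and "0 \<le> q" and small: "q * (1 + real N / 2)\<^sup>2 \<le> 1 / 2"
  shows "real N * q / 2 \<le> w k"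
proof -
  have "real j * q / 2 \<le> w (k + N - j)" if "j \<le> N" for j
    using that
  proof (induction j)
    case 0
    then show ?case using w_nonneg by simp
  next
    case (Suc j)
    define i where "i = k + N - Suc j"
    have i: "k + N - j = Suc i" "k < Suc i" "Suc i \<le> k + N"
      using Suc.prems by (auto simp: i_def)
    define t where "t = real j * q / 2"
    have t: "t \<le> w (Suc i)" "0 \<le> t"
      using Suc assms(2) by (auto simp: i t_def)
    have "(t + q / 2) * (t + q) \<le> (t + q) * (t + q)"
      using t assms(2) by (intro mult_right_mono) auto
    also have "\<dots> = q * (q * (1 + real j / 2)\<^sup>2)"
      by (simp add: t_def field_simps power2_eq_square)
    also have "\<dots> \<le> q * (q * (1 + real N / 2)\<^sup>2)"
      using assms(2) Suc.prems by (intro mult_left_mono power_mono) auto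
    also have "\<dots> \<le> q * (1 / 2)"
      using assms(2) small by (intro mult_left_mono) auto
    finally have "(t + q / 2) * (t + q) \<le> q / 2"
      by simp
    moreover have "(t + q / 2) * (1 + q + t) = t + q / 2 + (t + q / 2) * (t + q)"
      by (simp add: field_simps)
    ultimately have "(t + q / 2) * (1 + q + t) \<le> q + t"
      by linarith
    then have "t + q / 2 \<le> (q + t) / (1 + q + t)"
      using t assms(2) by (simp add: pos_le_divide_eq)
    also have "\<dots> \<le> w i"
      unfolding w_step[of i] using riccati_mono[of q "p (Suc i)" t "w (Suc i)"] p i t assms(2)
      by simp
    finally show ?case
      by (simp add: t_def i_def field_simps)
  qed
  from this[of N] show ?thesis by simp
qed

text \<open>With \<open>p\<close> dropped, a step adds \<open>1\<close> to the reciprocal of the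
  slope, so \<open>k\<close> steps turn \<open>1 / s\<close> into \<open>1 / s + k\<close>.\<close>

lemma w_lower_transport:
  assumes "0 \<le> s" "s \<le> w k"
  shows "s / (1 + real k * s) \<le> w 0"
  using assms
proof (induction k arbitrary: s)
  case 0
  then show ?case by simp
next
  case (Suc k)
  have "s / (1 + s) \<le> w k"
    unfolding w_step[of k] using riccati_mono[of 0 "p (Suc k)" s "w (Suc k)"] Suc.prems p_nonneg
    by simp
  moreover have "0 \<le> s / (1 + s)"
    using Suc.prems by simp
  ultimately have "(s / (1 + s)) / (1 + real k * (s / (1 + s))) \<le> w 0"
    by (intro Suc.IH)
  also have "(s / (1 + s)) / (1 + real k * (s / (1 + s))) = s / (1 + real (Suc k) * s)"
  proof -
    have "1 + s \<noteq> 0"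
      using Suc.prems by simp
    then have "1 + real k * (s / (1 + s)) = (1 + real (Suc k) * s) / (1 + s)"
      by (simp add: field_simps)
    then show ?thesis
      using \<open>1 + s \<noteq> 0\<close> by simp
  qed
  finally show ?case .
qed

end


section \<open>Backward orbits of the lifted map\<close>

lemma abs_le_abs_plus_int:
  fixes y :: real
  assumes "\<bar>y\<bar> \<le> 1 / 2"
  shows "\<bar>y\<bar> \<le> \<bar>y + of_int i\<bar>"
proof (cases "i = 0")
  case False
  then have "\<bar>real_of_int i\<bar> \<ge> 1" by linarith
  then show ?thesis using assms by linarith
qed simp

lemma nat_floor_bounds:
  fixes x :: real
  assumes "1 \<le> x"
  shows "1 \<le> real (nat \<lfloor>x\<rfloor>)" "real (nat \<lfloor>x\<rfloor>) \<le> x" "x \<le> real (nat \<lfloor>x\<rfloor>) + 1"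
proof -
  have "1 \<le> \<lfloor>x\<rfloor>"
    using assms by simp
  then show "1 \<le> real (nat \<lfloor>x\<rfloor>)" "real (nat \<lfloor>x\<rfloor>) \<le> x" "x \<le> real (nat \<lfloor>x\<rfloor>) + 1"
    by linarith+
qed

text \<open>Quantitative form of the cubic tangency at 0, with \<open>g\<close> the derivative of
  the lift \<open>H\<close>. The lower bound is confined to a fundamental domain because
  \<open>g\<close> vanishes at every integer.\<close>

locale cubic_lift =
  fixes H g :: "real \<Rightarrow> real" and M \<beta> :: real
  assumes H_deriv: "(H has_real_derivative g x) (at x)"
    and H_shift: "H (x + of_int m) - H x \<in> \<int>"
    and g_shift: "g (x + of_int m) = g x"
    and H_upper: "\<bar>x\<bar> \<le> 1 \<Longrightarrow> \<bar>H x\<bar> \<le> M * \<bar>x\<bar> ^ 3"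
    and g_upper: "\<bar>x\<bar> \<le> 1 \<Longrightarrow> g x \<le> M * x\<^sup>2"
    and g_lower: "\<bar>x\<bar> \<le> 1 / 2 \<Longrightarrow> \<beta> * x\<^sup>2 \<le> g x"
    and M_ge: "1 \<le> M" and \<beta>_pos: "0 < \<beta>" and \<beta>_le: "\<beta> \<le> 1"
begin

text \<open>Translating by the nearest integer moves \<open>x\<close> into the fundamental domain,
  where \<open>g_lower\<close> applies.\<close>

lemma g_ge_far_from_Ints:
  assumes "0 \<le> \<epsilon>" and "\<And>m :: int. \<epsilon> \<le> \<bar>x - of_int m\<bar>"
  shows "\<beta> * \<epsilon>\<^sup>2 \<le> g x"
proof -
  define s where "s = x - of_int (round x)"
  have "\<bar>s\<bar> \<le> 1 / 2"
    unfolding s_def using of_int_round_abs_le[of x] by (simp add: abs_minus_commute)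
  then have "\<beta> * s\<^sup>2 \<le> g s"
    by (rule g_lower)
  moreover have "g s = g x"
    using g_shift[of x "- round x"] by (simp add: s_def)
  moreover have "\<beta> * \<epsilon>\<^sup>2 \<le> \<beta> * s\<^sup>2"
    using assms \<beta>_pos power_mono[of \<epsilon> "\<bar>s\<bar>" 2] by (simp add: s_def)
  ultimately show ?thesis by linarith
qed

lemma g_nonneg: "0 \<le> g x"
  using g_ge_far_from_Ints[of 0 x] by simp

lemma g_le: "g x \<le> M"
proof -
  define s where "s = x - of_int (round x)"
  have s: "\<bar>s\<bar> \<le> 1 / 2"
    unfolding s_def using of_int_round_abs_le[of x] by (simp add: abs_minus_commute)
  then have "g s \<le> M * s\<^sup>2"
    by (intro g_upper) simp
  also have "\<dots> \<le> M * 1"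
    using M_ge s by (intro mult_left_mono) (auto simp: abs_square_le_1)
  finally show ?thesis
    using g_shift[of x "- round x"] by (simp add: s_def)
qed

text \<open>Time horizon in units of \<open>1 / \<rho>\<close>: up to time
  \<open>\<tau> / \<rho>\<close> the total change of \<open>y\<close> is at most
  \<open>8 * M * \<tau> * \<rho>\<^sup>2 = \<rho>\<^sup>2 / 4\<close>.\<close>

definition \<tau> :: real where "\<tau> = 1 / (32 * M)"
text \<open>Threshold for being far from \<open>x = 0\<close> at scale \<rho>. The factor 48 leaves
  room for \<open>12 * \<delta> / \<rho>\<close> steps of drift followed by a window of
  \<open>\<delta> / (2 * \<rho>)\<close> steps before the horizon.\<close>

definition \<delta> :: real where "\<delta> = \<tau> / 48"

text \<open>The summands come from the barrier, from the \<open>2 / N\<close> decay, and from the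
  trivial bound \<open>slope 0 \<le> 1\<close> when \<rho> exceeds
  \<open>\<delta> / 4\<close>.\<close>

definition K_upper :: real where
  "K_upper = 8 * M + 4 / \<tau> + 4 / \<delta>"
text \<open>The two entries serve small and large \<rho> respectively.\<close>

definition K_lower :: real where
  "K_lower = min (\<beta> * \<delta> ^ 3 / 16) (\<beta> * ((\<delta> / 4)\<^sup>2 / (64 * M))\<^sup>2 / 4)"

lemma \<tau>_pos: "0 < \<tau>" and \<tau>_le: "\<tau> \<le> 1 / 32" and M_\<tau>: "M * \<tau> = 1 / 32"
  using M_ge by (auto simp: \<tau>_def field_simps)

lemma \<delta>_pos: "0 < \<delta>" and \<delta>_le: "\<delta> \<le> 1 / 1536"
  using \<tau>_pos \<tau>_le by (auto simp: \<delta>_def)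

lemma K_upper_pos: "0 < K_upper" and K_lower_pos: "0 < K_lower"
  using M_ge \<tau>_pos \<delta>_pos \<beta>_pos by (auto simp: K_upper_def K_lower_def intro!: add_pos_pos)

end

text \<open>An orbit of the lifted inverse map in the plane. Only its starting point lies in the
  fundamental square; later points are not reduced modulo 1.\<close>

locale backward_orbit = cubic_lift +
  fixes X Y :: "nat \<Rightarrow> real"
  assumes X_step: "X (Suc k) = X k - Y k"
    and Y_step: "Y (Suc k) = Y k - H (X (Suc k))"
    and X0_le: "\<bar>X 0\<bar> \<le> 1 / 2" and Y0_le: "\<bar>Y 0\<bar> \<le> 1 / 2"
begin

definition \<rho> :: real where "\<rho> = \<bar>X 0\<bar> + sqrt \<bar>Y 0\<bar>"

lemma \<rho>_nonneg: "0 \<le> \<rho>"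
  by (simp add: \<rho>_def)

lemma abs_Y0_le: "\<bar>Y 0\<bar> \<le> \<rho>\<^sup>2"
proof -
  have "(sqrt \<bar>Y 0\<bar>)\<^sup>2 \<le> \<rho>\<^sup>2"
    unfolding \<rho>_def by (intro power_mono) auto
  then show ?thesis by simp
qed

lemma \<rho>_le: "\<rho> \<le> 2"
proof -
  have "sqrt \<bar>Y 0\<bar> \<le> sqrt 1"
    using Y0_le by (intro real_sqrt_le_mono) simp
  then have "sqrt \<bar>Y 0\<bar> \<le> 1"
    by simp
  then show ?thesis
    using X0_le unfolding \<rho>_def by linarith
qed

text \<open>A bootstrap: \<open>\<bar>Y k\<bar> \<le> 2 * \<rho>\<^sup>2\<close> controls the drift
  of \<open>X\<close>, and \<open>\<bar>X k\<bar> \<le> 2 * \<rho>\<close> bounds \<open>H\<close>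
  by \<open>8 * M * \<rho> ^ 3\<close>, which controls the drift of \<open>Y\<close>. The bound on
  the time closes the loop, so all four estimates are proved together.\<close>

lemma orbit_increments:
  assumes "\<rho> \<le> 1 / 4" "real k * \<rho> \<le> \<tau>"
  shows "\<bar>Y k - Y 0\<bar> \<le> 8 * M * \<rho> ^ 3 * real k \<and> \<bar>X k - X 0\<bar> \<le> 2 * \<rho>\<^sup>2 * real k
    \<and> \<bar>Y k - Y 0\<bar> \<le> \<rho>\<^sup>2 / 4 \<and> \<bar>X k\<bar> \<le> 2 * \<rho>"
  using assms(2)
proof (induction k)
  case 0
  then show ?case using \<rho>_nonneg by (simp add: \<rho>_def)
next
  case (Suc k)
  have kl: "real k * \<rho> \<le> \<tau>"
    using Suc.prems \<rho>_nonneg by (simp add: algebra_simps)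
  note IH = Suc.IH[OF kl]
  have "\<bar>Y k\<bar> \<le> 2 * \<rho>\<^sup>2"
    using IH abs_Y0_le by linarith
  then have X: "\<bar>X (Suc k) - X 0\<bar> \<le> 2 * \<rho>\<^sup>2 * real (Suc k)"
    using IH X_step[of k] by (simp only: of_nat_Suc distrib_left mult_1_right) linarith
  also have "\<dots> = 2 * \<rho> * (real (Suc k) * \<rho>)"
    by (simp add: power2_eq_square)
  also have "\<dots> \<le> 2 * \<rho> * \<tau>"
    using Suc.prems \<rho>_nonneg by (intro mult_left_mono) auto
  also have "\<dots> \<le> \<rho>"
    using \<tau>_le \<rho>_nonneg mult_left_mono[of \<tau> "1/32" \<rho>] by simp
  finally have X': "\<bar>X (Suc k)\<bar> \<le> 2 * \<rho>"
    using \<rho>_def real_sqrt_ge_zero[of "\<bar>Y 0\<bar>"] by linarith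
  have "\<bar>H (X (Suc k))\<bar> \<le> M * \<bar>X (Suc k)\<bar> ^ 3"
    using X' assms(1) by (intro H_upper) simp
  also have "\<dots> \<le> M * (2 * \<rho>) ^ 3"
    using X' M_ge by (intro mult_left_mono power_mono) auto
  also have "\<dots> = 8 * M * \<rho> ^ 3"
    by (simp add: power3_eq_cube)
  finally have Y: "\<bar>Y (Suc k) - Y 0\<bar> \<le> 8 * M * \<rho> ^ 3 * real (Suc k)"
    using IH Y_step[of k] by (simp only: of_nat_Suc distrib_left mult_1_right) linarith
  also have "\<dots> = 8 * M * \<rho>\<^sup>2 * (real (Suc k) * \<rho>)"
    by (simp add: power2_eq_square power3_eq_cube)
  also have "\<dots> \<le> 8 * M * \<rho>\<^sup>2 * \<tau>"
    using Suc.prems M_ge by (intro mult_left_mono) auto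
  also have "\<dots> = \<rho>\<^sup>2 / 4"
    using M_\<tau> by (simp add: algebra_simps)
  finally show ?case
    using X X' Y by simp
qed

text \<open>If \<open>\<bar>X 0\<bar> \<ge> 2 * \<delta> * \<rho>\<close>, the window starts at
  once, since \<open>N\<close> steps move \<open>X\<close> by at most
  \<open>\<delta> * \<rho>\<close>. Otherwise \<open>\<bar>Y 0\<bar>\<close> is of order
  \<open>\<rho>\<^sup>2\<close> and the window starts after a drift away from 0.\<close>

lemma orbit_far_window:
  assumes "0 < \<rho>" "\<rho> \<le> \<delta> / 4" "real N * \<rho> \<le> \<delta> / 2"
  obtains k where "real k * \<rho> \<le> \<tau>"
    and "\<And>j. k < j \<Longrightarrow> j \<le> k + N \<Longrightarrow> \<delta> * \<rho> \<le> \<bar>X j\<bar> \<and> \<bar>X j\<bar> \<le> 1 / 2"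
proof (cases "2 * \<delta> * \<rho> \<le> \<bar>X 0\<bar>")
  have l4: "\<rho> \<le> 1 / 4" and \<delta>\<tau>: "\<delta> \<le> \<tau>"
    using assms \<delta>_le \<tau>_pos by (auto simp: \<delta>_def)
  case True
  have "\<delta> * \<rho> \<le> \<bar>X j\<bar> \<and> \<bar>X j\<bar> \<le> 1 / 2" if "j \<le> N" for j
  proof -
    have j: "real j * \<rho> \<le> \<delta> / 2"
      using that assms mult_right_mono[of "real j" "real N" \<rho>] by linarith
    then have inc: "\<bar>X j - X 0\<bar> \<le> 2 * \<rho>\<^sup>2 * real j" "\<bar>X j\<bar> \<le> 2 * \<rho>"
      using orbit_increments[of j] l4 \<delta>\<tau> \<delta>_pos by auto
    have "2 * \<rho>\<^sup>2 * real j = 2 * \<rho> * (real j * \<rho>)"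
      by (simp add: power2_eq_square)
    also have "\<dots> \<le> 2 * \<rho> * (\<delta> / 2)"
      using j assms by (intro mult_left_mono) auto
    finally show ?thesis
      using inc True l4 by (auto simp: algebra_simps)
  qed
  then show ?thesis
    using that[of 0] \<tau>_pos by simp
next
  have l4: "\<rho> \<le> 1 / 4"
    using assms \<delta>_le by simp
  case False
  then have "3 / 4 * \<rho> \<le> sqrt \<bar>Y 0\<bar>"
    using \<delta>_le assms(1) mult_right_mono[of "2 * \<delta>" "1 / 4" \<rho>] \<rho>_def by linarith
  then have "(3 / 4 * \<rho>)\<^sup>2 \<le> \<bar>Y 0\<bar>"
    using assms(1) power_mono[of "3 / 4 * \<rho>" "sqrt \<bar>Y 0\<bar>" 2] by simp
  then have Y0: "\<rho>\<^sup>2 / 2 \<le> \<bar>Y 0\<bar>"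
    unfolding power_mult_distrib by (simp add: power2_eq_square)
  define \<sigma> where "\<sigma> = sgn (Y 0)"
  have \<sigma>: "\<bar>\<sigma>\<bar> = 1" "\<sigma> * Y 0 = \<bar>Y 0\<bar>"
    using Y0 assms(1) by (auto simp: \<sigma>_def sgn_if)
  \<comment> \<open>\<open>Y\<close> changes by at most half of \<open>\<rho>\<^sup>2 / 2\<close>,
    so it keeps its sign \<sigma> and \<open>X\<close> moves in one direction at speed at least
    \<open>\<rho>\<^sup>2 / 4\<close>.\<close>
  have drift: "\<sigma> * (X 0 - X k) \<ge> real k * (\<rho>\<^sup>2 / 4)" if "real k * \<rho> \<le> \<tau>" for k
    using that
  proof (induction k)
    case 0
    then show ?case by simp
  next
    case (Suc k)
    have kl: "real k * \<rho> \<le> \<tau>"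
      using Suc.prems \<rho>_nonneg by (simp add: algebra_simps)
    have "\<bar>Y k - Y 0\<bar> \<le> \<rho>\<^sup>2 / 4"
      using orbit_increments[OF l4 kl] by simp
    then have "\<bar>\<sigma> * (Y k - Y 0)\<bar> \<le> \<rho>\<^sup>2 / 4"
      using \<sigma> by (simp add: abs_mult)
    then have "\<sigma> * Y k \<ge> \<rho>\<^sup>2 / 4"
      using Y0 \<sigma> unfolding right_diff_distrib by linarith
    moreover have "\<sigma> * (X 0 - X (Suc k)) = \<sigma> * (X 0 - X k) + \<sigma> * Y k"
      by (simp add: X_step algebra_simps)
    moreover have "real (Suc k) * (\<rho>\<^sup>2 / 4) = real k * (\<rho>\<^sup>2 / 4) + \<rho>\<^sup>2 / 4"
      by (simp only: of_nat_Suc distrib_right)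
    ultimately show ?case
      using Suc.IH[OF kl] by linarith
  qed
  \<comment> \<open>After this time the displacement is at least
    \<open>3 * \<delta> * \<rho>\<close>, which exceeds
    \<open>\<bar>X 0\<bar> < 2 * \<delta> * \<rho>\<close> by
    \<open>\<delta> * \<rho>\<close>.\<close>
  define k where "k = nat \<lceil>12 * \<delta> / \<rho>\<rceil>"
  have "0 \<le> 12 * \<delta> / \<rho>"
    using \<delta>_pos assms(1) by simp
  then have "12 * \<delta> / \<rho> \<le> real k" "real k \<le> 12 * \<delta> / \<rho> + 1"
    unfolding k_def by linarith+
  then have k: "12 * \<delta> \<le> real k * \<rho>" "real k * \<rho> \<le> 12 * \<delta> + \<rho>"
    using assms(1) by (auto simp: field_simps)
  have \<tau>\<delta>: "\<tau> = 48 * \<delta>"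
    by (simp add: \<delta>_def)
  have "\<delta> * \<rho> \<le> \<bar>X j\<bar> \<and> \<bar>X j\<bar> \<le> 1 / 2" if "k < j" "j \<le> k + N" for j
  proof -
    have j: "12 * \<delta> \<le> real j * \<rho>" "real j * \<rho> \<le> real (k + N) * \<rho>"
      using that k(1) assms(1) mult_right_mono[of "real k" "real j" \<rho>] by linarith (use that assms(1) in simp)
    then have j\<tau>: "real j * \<rho> \<le> \<tau>"
      using k assms \<tau>\<delta> by (simp add: algebra_simps)
    have "3 * \<delta> * \<rho> \<le> real j * \<rho> * (\<rho> / 4)"
      using mult_right_mono[OF j(1), of "\<rho> / 4"] assms(1) by simp
    also have "\<dots> \<le> \<sigma> * (X 0 - X j)"
      using drift[OF j\<tau>] by (simp add: power2_eq_square)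
    also have "\<dots> \<le> \<bar>X 0 - X j\<bar>"
      using abs_ge_self[of "\<sigma> * (X 0 - X j)"] \<sigma> by (simp add: abs_mult)
    finally have "3 * \<delta> * \<rho> \<le> \<bar>X 0 - X j\<bar>" .
    then have "\<delta> * \<rho> \<le> \<bar>X j\<bar>"
      using False by linarith
    then show ?thesis
      using orbit_increments[OF l4 j\<tau>] l4 by simp
  qed
  moreover have "real k * \<rho> \<le> \<tau>"
    using k assms \<tau>\<delta> \<delta>_pos by linarith
  ultimately show ?thesis
    using that by blast
qed

text \<open>If \<open>X 1\<close> is close to an integer, then \<open>X 0\<close> is close to
  \<open>Y 0\<close> modulo 1, so \<open>\<rho> \<ge> r\<close> forces \<open>Y 0\<close> to be
  large; and \<open>X 2\<close> is then close to \<open>- Y 0\<close> modulo 1, hence far from the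
  integers.\<close>

lemma g_lower_two_steps:
  assumes "0 < r" "r \<le> 1" "r \<le> \<rho>"
  defines "\<epsilon> \<equiv> r\<^sup>2 / (64 * M)"
  shows "\<beta> * \<epsilon>\<^sup>2 \<le> g (X 1) \<or> \<beta> * \<epsilon>\<^sup>2 \<le> g (X 2)"
proof (cases "\<forall>m :: int. \<epsilon> \<le> \<bar>X 1 - of_int m\<bar>")
  have "0 < \<epsilon>"
    using assms M_ge by (simp add: \<epsilon>_def)
  case True
  then show ?thesis
    using g_ge_far_from_Ints[of \<epsilon> "X 1"] \<open>0 < \<epsilon>\<close> by simp
next
  have r2: "0 < r\<^sup>2" "r\<^sup>2 \<le> r"
    using assms by (auto simp: power2_eq_square)
  have \<epsilon>: "0 < \<epsilon>" "M * \<epsilon> = r\<^sup>2 / 64"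
    using M_ge r2 by (auto simp: \<epsilon>_def)
  have \<epsilon>M: "\<epsilon> \<le> M * \<epsilon>"
    using M_ge \<epsilon> by simp
  case False
  then obtain m :: int where m: "\<bar>X 1 - of_int m\<bar> < \<epsilon>"
    by (meson not_le)
  define s where "s = X 1 - of_int m"
  have s: "\<bar>s\<bar> < \<epsilon>" "\<bar>s\<bar> \<le> 1"
    using m \<epsilon> \<epsilon>M r2 assms by (auto simp: s_def)
  have "\<bar>H s\<bar> \<le> M * \<bar>s\<bar> ^ 3"
    using s by (intro H_upper) simp
  also have "\<dots> \<le> M * \<bar>s\<bar>"
    using M_ge s power_decreasing[of 1 3 "\<bar>s\<bar>"] by (intro mult_left_mono) auto
  also have "\<dots> \<le> M * \<epsilon>"
    using M_ge s by (intro mult_left_mono) auto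
  finally have Hs: "\<bar>s + H s\<bar> \<le> 2 * (M * \<epsilon>)"
    using s \<epsilon>M by linarith
  \<comment> \<open>\<open>\<bar>X 0\<bar>\<close> is already the distance to the nearest integer,
    so it cannot exceed the distance to \<open>m\<close>.\<close>
  have "\<bar>X 0\<bar> \<le> \<bar>X 0 + of_int (- m)\<bar>"
    by (rule abs_le_abs_plus_int[OF X0_le])
  also have "\<dots> = \<bar>s + Y 0\<bar>"
    using X_step[of 0] by (simp add: s_def)
  finally have X0: "\<bar>X 0\<bar> \<le> \<epsilon> + \<bar>Y 0\<bar>"
    using s by linarith
  \<comment> \<open>With \<open>\<bar>Y 0\<bar> \<le> sqrt \<bar>Y 0\<bar>\<close> the previous
    bound becomes \<open>\<rho> \<le> \<epsilon> + 2 * sqrt \<bar>Y 0\<bar>\<close>.\<close>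
  have "\<bar>Y 0\<bar> = sqrt \<bar>Y 0\<bar> * sqrt \<bar>Y 0\<bar>"
    by simp
  also have "\<dots> \<le> sqrt \<bar>Y 0\<bar> * 1"
    using Y0_le by (intro mult_left_mono) auto
  finally have "r / 4 \<le> sqrt \<bar>Y 0\<bar>"
    using X0 assms(3) \<epsilon> \<epsilon>M r2 unfolding \<rho>_def by linarith
  then have Y0: "r\<^sup>2 / 16 \<le> \<bar>Y 0\<bar>"
    using assms(1) power_mono[of "r / 4" "sqrt \<bar>Y 0\<bar>" 2] by (simp add: power_divide)
  obtain i :: int where i: "H (X 1) - H s = of_int i"
    using H_shift[of s m] by (auto simp: s_def elim: Ints_cases)
  have X2: "X 2 = s + H s - Y 0 + of_int (m + i)"
    using X_step[of 0] X_step[of 1] Y_step[of 0] i by (simp add: s_def numeral_2_eq_2)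
  \<comment> \<open>The constant 64 in \<epsilon> makes
    \<open>\<bar>s + H s\<bar> \<le> r\<^sup>2 / 32\<close>, half of the lower bound for
    \<open>\<bar>Y 0\<bar>\<close>.\<close>
  have "\<epsilon> \<le> \<bar>X 2 - of_int n\<bar>" for n :: int
  proof -
    have "\<bar>Y 0\<bar> \<le> \<bar>Y 0 + of_int (n - m - i)\<bar>"
      by (rule abs_le_abs_plus_int[OF Y0_le])
    also have "\<dots> = \<bar>(s + H s) - (X 2 - of_int n)\<bar>"
      by (simp add: X2)
    finally have "\<bar>Y 0\<bar> \<le> \<bar>s + H s\<bar> + \<bar>X 2 - of_int n\<bar>"
      by linarith
    then show ?thesis
      using Hs \<epsilon> \<epsilon>M Y0 by linarith
  qed
  then show ?thesis
    using g_ge_far_from_Ints[of \<epsilon> "X 2"] \<epsilon> by simp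
qed

end


section \<open>Slopes of vectors contracted in backward time\<close>

locale contracted_vector = backward_orbit +
  fixes a b :: "nat \<Rightarrow> real"
  assumes a_step: "a (Suc k) = a k - b k"
    and b_step: "b (Suc k) = b k - g (X (Suc k)) * a (Suc k)"
    and nonzero: "a 0 \<noteq> 0 \<or> b 0 \<noteq> 0"
    and a_tendsto: "a \<longlonglongrightarrow> 0" and b_tendsto: "b \<longlonglongrightarrow> 0"
begin

lemma quadratic_form_step:
  "a k * b k - a (Suc k) * b (Suc k) = g (X (Suc k)) * (a (Suc k))\<^sup>2 + (b k)\<^sup>2"
proof -
  have a: "a k = a (Suc k) + b k" and b: "b (Suc k) = b k - g (X (Suc k)) * a (Suc k)"
    using a_step[of k] b_step[of k] by auto
  show ?thesis
    unfolding a b by (simp add: algebra_simps power2_eq_square)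
qed

lemma quadratic_form_decreasing: "a (Suc k) * b (Suc k) \<le> a k * b k"
  using quadratic_form_step[of k] g_nonneg[of "X (Suc k)"]
  by (smt (verit) mult_nonneg_nonneg zero_le_power2)

lemma quadratic_form_nonneg: "0 \<le> a k * b k"
proof (rule LIMSEQ_le_const2)
  show "(\<lambda>n. a n * b n) \<longlonglongrightarrow> 0"
    using tendsto_mult[OF a_tendsto b_tendsto] by simp
  have "decseq (\<lambda>n. a n * b n)"
    by (rule decseq_SucI) (rule quadratic_form_decreasing)
  then show "\<exists>N. \<forall>n\<ge>N. a n * b n \<le> a k * b k"
    by (auto simp: decseq_def)
qed

lemma vector_nonzero: "a k \<noteq> 0 \<or> b k \<noteq> 0"
proof (induction k)
  case 0
  then show ?case by (rule nonzero)
next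
  case (Suc k)
  then show ?case
    using a_step[of k] b_step[of k] by auto
qed

text \<open>A vertical vector has product 0, and one step further back the product would be
  negative.\<close>

lemma a_nonzero: "a k \<noteq> 0"
proof
  assume "a k = 0"
  then have "g (X (Suc k)) * (a (Suc k))\<^sup>2 + (b k)\<^sup>2 \<le> 0"
    using quadratic_form_step[of k] quadratic_form_nonneg[of "Suc k"] by simp
  moreover have "0 \<le> g (X (Suc k)) * (a (Suc k))\<^sup>2"
    by (simp add: g_nonneg)
  ultimately have "(b k)\<^sup>2 \<le> 0"
    by linarith
  then show False
    using vector_nonzero[of k] \<open>a k = 0\<close> by simp
qed

definition slope :: "nat \<Rightarrow> real" where "slope k = b k / a k"

sublocale riccati "\<lambda>k. g (X k)" slope
proof
  fix k
  show "0 \<le> g (X k)"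
    by (rule g_nonneg)
  show "0 \<le> slope k"
    using quadratic_form_nonneg[of k]
    by (auto simp: slope_def zero_le_divide_iff zero_le_mult_iff)
next
  fix k
  let ?p = "g (X (Suc k))" and ?u = "slope (Suc k)"
  have bk: "b k = (?p + ?u) * a (Suc k)"
    using b_step[of k] a_nonzero[of "Suc k"] by (simp add: slope_def field_simps)
  moreover have "a k = (1 + ?p + ?u) * a (Suc k)"
    using a_step[of k] bk by (simp add: algebra_simps)
  ultimately show "slope k = (?p + ?u) / (1 + ?p + ?u)"
    using a_nonzero[of "Suc k"] by (simp add: slope_def)
qed

text \<open>The origin is fixed and the derivative there is a shear, so \<open>b\<close> is constant
  along the orbit; tending to 0, it vanishes.\<close>

lemma slope_degenerate:
  assumes "\<rho> = 0"
  shows "slope 0 = 0"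
proof -
  have XY0: "X 0 = 0" "Y 0 = 0"
    using assms by (auto simp: \<rho>_def add_nonneg_eq_0_iff)
  have "H 0 = 0" "g 0 = 0"
    using H_upper[of 0] g_upper[of 0] g_nonneg[of 0] by auto
  then have XY: "X k = 0 \<and> Y k = 0" for k
    by (induction k) (auto simp: XY0 X_step Y_step)
  have "b k = b 0" for k
    by (induction k) (auto simp: b_step XY \<open>g 0 = 0\<close>)
  then have "b = (\<lambda>_. b 0)"
    by auto
  then have "b 0 = 0"
    using b_tendsto LIMSEQ_const_iff by metis
  then show ?thesis
    by (simp add: slope_def)
qed

text \<open>\<open>w_upper\<close> with barrier \<open>8 * M * \<rho>\<close> and \<open>N\<close>
  about \<open>\<tau> / \<rho>\<close>. Rounding costs a factor 2, so the decay alternative gives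
  \<open>2 / N \<le> 4 * \<rho> / \<tau>\<close>.\<close>

lemma slope_upper:
  assumes "0 < \<rho>" "\<rho> \<le> \<delta> / 4"
  shows "slope 0 \<le> (8 * M + 4 / \<tau>) * \<rho>"
proof -
  have \<rho>: "\<rho> \<le> 1 / 4" "\<rho> \<le> \<tau>"
    using assms \<delta>_le \<tau>_pos by (auto simp: \<delta>_def)
  define N where "N = nat \<lfloor>\<tau> / \<rho>\<rfloor>"
  have "1 \<le> \<tau> / \<rho>"
    using \<rho> assms(1) by simp
  then have fl: "1 \<le> real N" "real N \<le> \<tau> / \<rho>" "\<tau> / \<rho> \<le> real N + 1"
    unfolding N_def by (rule nat_floor_bounds)+
  have N1: "\<rho> \<le> real N * \<rho>"
    using fl(1) assms(1) by simp
  have "\<tau> \<le> (real N + 1) * \<rho>"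
    using fl(3) assms(1) by (simp add: pos_divide_le_eq)
  then have N: "real N * \<rho> \<le> \<tau>" "\<tau> \<le> 2 * (real N * \<rho>)"
    using fl(2) N1 assms(1) unfolding distrib_right by (simp add: pos_le_divide_eq, linarith)
  have "g (X j) \<le> (8 * M * \<rho>)\<^sup>2 / 2" if "j \<le> N" for j
  proof -
    have "real j * \<rho> \<le> \<tau>"
      using that N assms(1) mult_right_mono[of "real j" "real N" \<rho>] by linarith
    then have X: "\<bar>X j\<bar> \<le> 2 * \<rho>"
      using orbit_increments \<rho> by simp
    then have "g (X j) \<le> M * (X j)\<^sup>2"
      using \<rho> by (intro g_upper) simp
    also have "\<dots> \<le> M * (2 * \<rho>)\<^sup>2"
      using X M_ge power_mono[of "\<bar>X j\<bar>" "2 * \<rho>" 2] by (intro mult_left_mono) auto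
    also have "\<dots> \<le> M * M * (2 * \<rho>)\<^sup>2"
      using M_ge by (intro mult_right_mono) auto
    also have "\<dots> \<le> (8 * M * \<rho>)\<^sup>2 / 2"
      using zero_le_square[of "M * \<rho>"] by (simp add: power2_eq_square ac_simps)
    finally show ?thesis .
  qed
  moreover have "0 \<le> 8 * M * \<rho>"
    using M_ge assms(1) by simp
  ultimately have "slope 0 \<le> 8 * M * \<rho> \<or> slope 0 * real N \<le> 2"
    by (intro w_upper) auto
  then show ?thesis
  proof
    assume "slope 0 \<le> 8 * M * \<rho>"
    moreover have "0 \<le> 4 / \<tau> * \<rho>"
      using \<tau>_pos assms(1) by simp
    ultimately show ?thesis
      by (simp add: algebra_simps)
  next
    assume u: "slope 0 * real N \<le> 2"
    have "slope 0 * \<tau> \<le> slope 0 * (2 * (real N * \<rho>))"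
      using N w_nonneg by (intro mult_left_mono) auto
    also have "\<dots> = (slope 0 * real N) * (2 * \<rho>)"
      by simp
    also have "\<dots> \<le> 2 * (2 * \<rho>)"
      using u assms(1) by (intro mult_right_mono) auto
    finally have "slope 0 \<le> 4 / \<tau> * \<rho>"
      using \<tau>_pos by (simp add: field_simps)
    moreover have "0 \<le> 8 * M * \<rho>"
      using M_ge assms(1) by simp
    ultimately show ?thesis
      by (simp add: algebra_simps)
  qed
qed

text \<open>The slope grows to order \<rho> across the far window and is then carried to time 0 over
  at most \<open>\<tau> / \<rho>\<close> steps, which costs at most a factor 2.\<close>

lemma slope_lower:
  assumes "0 < \<rho>" "\<rho> \<le> \<delta> / 4"
  shows "\<beta> * \<delta> ^ 3 / 16 * \<rho> \<le> slope 0"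
proof -
  define N where "N = nat \<lfloor>\<delta> / (2 * \<rho>)\<rfloor>"
  have "1 \<le> \<delta> / (2 * \<rho>)"
    using assms \<delta>_pos by simp
  then have fl: "1 \<le> real N" "real N \<le> \<delta> / (2 * \<rho>)" "\<delta> / (2 * \<rho>) \<le> real N + 1"
    unfolding N_def by (rule nat_floor_bounds)+
  have N1: "\<rho> \<le> real N * \<rho>"
    using fl(1) assms(1) by simp
  have "\<delta> \<le> (real N + 1) * (2 * \<rho>)"
    using fl(3) assms(1) by (simp add: pos_divide_le_eq)
  then have N: "real N * \<rho> \<le> \<delta> / 2" "\<delta> \<le> 4 * (real N * \<rho>)"
    using fl(2) N1 assms(1) unfolding distrib_right by (simp add: pos_le_divide_eq, linarith)
  obtain k where k: "real k * \<rho> \<le> \<tau>"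
    and far: "\<And>j. k < j \<Longrightarrow> j \<le> k + N \<Longrightarrow> \<delta> * \<rho> \<le> \<bar>X j\<bar> \<and> \<bar>X j\<bar> \<le> 1 / 2"
    using orbit_far_window[OF assms N(1)] by blast
  define q where "q = \<beta> * (\<delta> * \<rho>)\<^sup>2"
  have q_nonneg: "0 \<le> q"
    using \<beta>_pos by (simp add: q_def)
  have q_le: "q \<le> g (X j)" if "k < j" "j \<le> k + N" for j
  proof -
    have "q \<le> \<beta> * (X j)\<^sup>2"
      unfolding q_def using far[OF that] \<beta>_pos \<delta>_pos assms(1)
        power_mono[of "\<delta> * \<rho>" "\<bar>X j\<bar>" 2]
      by (intro mult_left_mono) auto
    also have "\<dots> \<le> g (X j)"
      using far[OF that] by (intro g_lower) simp
    finally show ?thesis .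
  qed
  have "q * (1 + real N / 2)\<^sup>2 = \<beta> * (\<delta> * (\<rho> + real N * \<rho> / 2))\<^sup>2"
    by (simp add: q_def field_simps power2_eq_square)
  also have "\<dots> \<le> 1 * (1 / 2)\<^sup>2"
  proof (intro mult_mono power_mono)
    have "\<delta> * (\<rho> + real N * \<rho> / 2) \<le> \<delta> * 1"
      using N assms \<delta>_le \<delta>_pos by (intro mult_left_mono) auto
    then show "\<delta> * (\<rho> + real N * \<rho> / 2) \<le> 1 / 2"
      using \<delta>_le by simp
  qed (use \<beta>_le \<beta>_pos \<delta>_pos assms in auto)
  finally have small: "q * (1 + real N / 2)\<^sup>2 \<le> 1 / 2"
    by (simp add: power2_eq_square)
  \<comment> \<open>The guaranteed gain \<open>real N * q / 2\<close>, evaluated with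
    \<open>real N * \<rho> \<ge> \<delta> / 4\<close>.\<close>
  define s where "s = \<beta> * \<delta> ^ 3 * \<rho> / 8"
  have s_nonneg: "0 \<le> s"
    using \<beta>_pos \<delta>_pos assms(1) by (simp add: s_def)
  have "s = \<beta> * \<delta>\<^sup>2 * \<rho> * \<delta> / 8"
    by (simp add: s_def power2_eq_square power3_eq_cube)
  also have "\<dots> \<le> \<beta> * \<delta>\<^sup>2 * \<rho> * (4 * (real N * \<rho>)) / 8"
    using N \<beta>_pos assms(1) by (intro divide_right_mono mult_left_mono) auto
  also have "\<dots> = real N * q / 2"
    by (simp add: q_def power2_eq_square)
  also have "\<dots> \<le> slope k"
    using q_le q_nonneg small by (rule w_lower_window)
  finally have "s / (1 + real k * s) \<le> slope 0"
    using s_nonneg by (intro w_lower_transport)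
  moreover have "s / 2 \<le> s / (1 + real k * s)"
  proof -
    have "real k * s = \<beta> * \<delta> ^ 3 / 8 * (real k * \<rho>)"
      by (simp add: s_def)
    also have "\<dots> \<le> 1 * 1"
    proof (intro mult_mono)
      have "\<delta> ^ 3 \<le> 1"
        using \<delta>_pos \<delta>_le by (intro power_le_one) auto
      then have "\<beta> * \<delta> ^ 3 \<le> 1"
        using \<beta>_pos \<beta>_le \<delta>_pos by (intro mult_le_one) auto
      then show "\<beta> * \<delta> ^ 3 / 8 \<le> 1"
        by simp
    qed (use k \<tau>_le assms in auto)
    finally show ?thesis
      using s_nonneg by (intro divide_left_mono) (auto intro!: add_pos_nonneg)
  qed
  ultimately have "s / 2 \<le> slope 0"
    by linarith
  then show ?thesis
    by (simp add: s_def)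
qed

text \<open>A single point with \<open>g \<ge> e\<close> among the last two already produces slope
  at least \<open>e / 2\<close>; since \<open>\<rho> \<le> 2\<close>, this is at least
  \<open>e / 4 * \<rho>\<close>.\<close>

lemma slope_lower_far:
  assumes "\<delta> / 4 \<le> \<rho>"
  shows "\<beta> * ((\<delta> / 4)\<^sup>2 / (64 * M))\<^sup>2 / 4 * \<rho> \<le> slope 0"
proof -
  define e where "e = \<beta> * ((\<delta> / 4)\<^sup>2 / (64 * M))\<^sup>2"
  have "(\<delta> / 4)\<^sup>2 \<le> 1"
    using \<delta>_pos \<delta>_le by (intro power_le_one) auto
  then have "(\<delta> / 4)\<^sup>2 / (64 * M) \<le> 1 / 2"
    using M_ge by (simp add: divide_simps)
  then have "((\<delta> / 4)\<^sup>2 / (64 * M))\<^sup>2 \<le> (1 / 2)\<^sup>2"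
    using M_ge by (intro power_mono) auto
  then have "e \<le> 1 * (1 / 2)\<^sup>2"
    unfolding e_def using \<beta>_pos \<beta>_le by (intro mult_mono) auto
  then have e: "0 \<le> e" "e \<le> 1 / 4"
    using \<beta>_pos by (auto simp: e_def power2_eq_square)
  have one_step: "e / (1 + e) \<le> slope k" if "e \<le> g (X (Suc k))" for k
    using riccati_mono[of e "g (X (Suc k))" 0 "slope (Suc k)"] that e w_nonneg w_step[of k]
    by simp
  have "e \<le> g (X 1) \<or> e \<le> g (X 2)"
    unfolding e_def using assms \<delta>_pos \<delta>_le by (intro g_lower_two_steps) auto
  then have "e / 2 \<le> slope 0"
  proof
    assume "e \<le> g (X 1)"
    then have "e / (1 + e) \<le> slope 0"
      using one_step[of 0] by simp
    moreover have "e / 2 \<le> e / (1 + e)"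
      using e by (intro divide_left_mono) auto
    ultimately show ?thesis by linarith
  next
    assume "e \<le> g (X 2)"
    then have "e / (1 + e) \<le> slope 1"
      using one_step[of 1] by (simp add: numeral_2_eq_2)
    then have "(e / (1 + e)) / (1 + real 1 * (e / (1 + e))) \<le> slope 0"
      using e by (intro w_lower_transport) auto
    moreover have "(e / (1 + e)) / (1 + real 1 * (e / (1 + e))) = e / (1 + 2 * e)"
      using e by (simp add: divide_simps)
    moreover have "e / 2 \<le> e / (1 + 2 * e)"
      using e by (intro divide_left_mono) auto
    ultimately show ?thesis by linarith
  qed
  moreover have "e / 4 * \<rho> \<le> e / 4 * 2"
    using e \<rho>_le by (intro mult_left_mono) auto
  ultimately have "e / 4 * \<rho> \<le> slope 0"
    by linarith
  then show ?thesis
    by (simp only: e_def)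
qed

lemma slope_bounds:
  shows "slope 0 \<le> K_upper * \<rho>" and "K_lower * \<rho> \<le> slope 0"
proof -
  have nn: "0 \<le> (8 * M + 4 / \<tau>) * \<rho>" "0 \<le> 4 / \<delta> * \<rho>"
    using M_ge \<tau>_pos \<delta>_pos \<rho>_nonneg by auto
  show "slope 0 \<le> K_upper * \<rho>"
  proof (cases "\<rho> \<le> \<delta> / 4")
    case True
    then have "slope 0 \<le> (8 * M + 4 / \<tau>) * \<rho>"
      using slope_upper slope_degenerate \<rho>_nonneg by (cases "\<rho> = 0") auto
    then show ?thesis
      using nn unfolding K_upper_def distrib_right[of _ "4 / \<delta>"] by linarith
  next
    case False
    then have "1 \<le> 4 / \<delta> * \<rho>"
      using \<delta>_pos by (simp add: field_simps)
    then show ?thesis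
      using nn w_le_1[of 0] unfolding K_upper_def distrib_right[of _ "4 / \<delta>"] by linarith
  qed
  let ?c = "\<beta> * \<delta> ^ 3 / 16" and ?d = "\<beta> * ((\<delta> / 4)\<^sup>2 / (64 * M))\<^sup>2 / 4"
  show "K_lower * \<rho> \<le> slope 0"
  proof (cases "\<rho> \<le> \<delta> / 4")
    case True
    have "K_lower * \<rho> \<le> ?c * \<rho>"
      using \<rho>_nonneg by (intro mult_right_mono) (auto simp: K_lower_def)
    also have "\<dots> \<le> slope 0"
      using True slope_lower slope_degenerate \<rho>_nonneg by (cases "\<rho> = 0") auto
    finally show ?thesis .
  next
    case False
    have "K_lower * \<rho> \<le> ?d * \<rho>"
      using \<rho>_nonneg by (intro mult_right_mono) (auto simp: K_lower_def)
    also have "\<dots> \<le> slope 0"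
      using False slope_lower_far by simp
    finally show ?thesis .
  qed
qed

end

section \<open>Lifts and derivatives on the torus\<close>

lemma proj_eq_iff: "proj x = proj y \<longleftrightarrow> x - y \<in> \<int>"
  by transfer simp

lemma proj_add: "proj (x + y) = proj x + proj y"
  by transfer simp

lemma proj_diff: "proj (x - y) = proj x - proj y"
  by transfer simp

lemma proj_minus: "proj (- x) = - proj x"
  by transfer simp

lemma proj_0: "proj 0 = 0"
  by transfer simp

lemma proj_add_of_int [simp]: "proj (x + of_int m) = proj x"
  by (simp add: proj_eq_iff)

lemma proj_surj: "\<exists>x. proj x = a"
  by transfer (metis diff_self Ints_0)

lemma coord_unique:
  assumes "- 1/2 < x" "x \<le> 1/2" "- 1/2 < y" "y \<le> 1/2" "proj x = proj y"
  shows "x = y"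
proof -
  have "x - y \<in> \<int>" "\<bar>x - y\<bar> < 1"
    using assms by (auto simp: proj_eq_iff)
  then show ?thesis
    using Ints_nonzero_abs_less1[of "x - y"] by auto
qed

lemma coord_ex: "\<exists>!x. - 1/2 < x \<and> x \<le> 1/2 \<and> proj x = a"
proof -
  obtain y where y: "proj y = a"
    using proj_surj by blast
  \<comment> \<open>Rounding by the ceiling puts the right endpoint, and not the left one, into the
    interval.\<close>
  have "proj (y - of_int \<lceil>y - 1/2\<rceil>) = a"
    using y by (simp add: proj_eq_iff flip: y)
  moreover have "- 1/2 < y - of_int \<lceil>y - 1/2\<rceil>" "y - of_int \<lceil>y - 1/2\<rceil> \<le> 1/2"
    by linarith+
  ultimately show ?thesis
    using coord_unique by blast
qed

lemma coord_bounds: "- 1/2 < coord a" "coord a \<le> 1/2" and proj_coord [simp]: "proj (coord a) = a"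
  using theI'[OF coord_ex[of a]] by (auto simp: coord_def)

lemma abs_coord_le: "\<bar>coord a\<bar> \<le> 1/2"
  using coord_bounds[of a] by (auto simp: abs_le_iff)

lemma coord_proj: "- 1/2 < x \<Longrightarrow> x \<le> 1/2 \<Longrightarrow> coord (proj x) = x"
  using coord_unique coord_bounds proj_coord by metis

lemma torus_proj_Pair [simp]: "torus_proj (x, y) = (proj x, proj y)"
  by (simp add: torus_proj_def)

lemma torus_proj_eq_iff:
  "torus_proj z = torus_proj w \<longleftrightarrow> fst z - fst w \<in> \<int> \<and> snd z - snd w \<in> \<int>"
  by (cases z; cases w) (simp add: proj_eq_iff)

lemma integer_valued_locally_constant:
  fixes f :: "'a::t2_space \<Rightarrow> real"
  assumes "isCont f z" "\<forall>\<^sub>F w in nhds z. f w \<in> \<int>"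
  shows "\<forall>\<^sub>F w in nhds z. f w = f z"
proof -
  have "(f \<longlongrightarrow> f z) (nhds z)"
    using assms(1) by (simp add: isCont_def tendsto_at_iff_tendsto_nhds)
  then have "\<forall>\<^sub>F w in nhds z. dist (f w) (f z) < 1"
    by (rule tendstoD) simp
  with assms(2) show ?thesis
  proof eventually_elim
    case (elim w)
    have "f w - f z \<in> \<int>"
      using elim(1) eventually_nhds_x_imp_x[OF assms(2)] by (rule Ints_diff)
    then show ?case
      using elim(2) Ints_nonzero_abs_less1[of "f w - f z"] by (auto simp: dist_real_def)
  qed
qed

text \<open>After an integer translation both lifts live near the same point. Their difference is
  continuous and integer valued, hence locally constant, and does not affect the derivative.\<close>

lemma has_torus_derivative_unique:
  assumes "has_torus_derivative F A \<xi>" "has_torus_derivative F B \<xi>"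
  shows "A = B"
proof -
  obtain z G where z: "torus_proj z = \<xi>" "(G has_derivative A) (at z)"
    and G: "\<forall>\<^sub>F w in nhds z. F (torus_proj w) = torus_proj (G w)"
    using assms(1) by (auto simp: has_torus_derivative_def)
  obtain z' G' where z': "torus_proj z' = \<xi>" "(G' has_derivative B) (at z')"
    and G': "\<forall>\<^sub>F w in nhds z'. F (torus_proj w) = torus_proj (G' w)"
    using assms(2) by (auto simp: has_torus_derivative_def)
  define d where "d = z' - z"
  define K where "K w = G' (w + d)" for w
  have "((\<lambda>w. w + d) has_derivative (\<lambda>x. x)) (at z)"
    by (auto intro!: derivative_eq_intros)
  moreover have "(G' has_derivative B) (at (z + d))"
    using z' by (simp add: d_def)
  ultimately have K_deriv: "(K has_derivative B) (at z)"
    unfolding K_def by (rule has_derivative_compose)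
  have shift: "torus_proj (w + d) = torus_proj w" for w
    using z(1) z'(1) torus_proj_eq_iff[of z' z] by (simp add: torus_proj_eq_iff d_def)
  have "((\<lambda>w. w + d) \<longlongrightarrow> z + d) (nhds z)"
    by (intro tendsto_intros filterlim_ident)
  then have "filterlim (\<lambda>w. w + d) (nhds z') (nhds z)"
    by (simp add: d_def)
  then have "\<forall>\<^sub>F w in nhds z. F (torus_proj (w + d)) = torus_proj (G' (w + d))"
    by (rule eventually_compose_filterlim[OF G'])
  with G have ev: "\<forall>\<^sub>F w in nhds z. torus_proj (K w) = torus_proj (G w)"
    by eventually_elim (simp add: shift K_def)
  have cont: "isCont K z" "isCont G z"
    using K_deriv z(2) has_derivative_continuous by blast+
  have "\<forall>\<^sub>F w in nhds z. fst (K w) - fst (G w) = fst (K z) - fst (G z)"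
    using cont ev
    by (intro integer_valued_locally_constant continuous_intros)
       (auto simp: torus_proj_eq_iff elim: eventually_mono)
  moreover have "\<forall>\<^sub>F w in nhds z. snd (K w) - snd (G w) = snd (K z) - snd (G z)"
    using cont ev
    by (intro integer_valued_locally_constant continuous_intros)
       (auto simp: torus_proj_eq_iff elim: eventually_mono)
  ultimately have "\<forall>\<^sub>F w in nhds z. K w - (K z - G z) = G w"
    by eventually_elim (auto simp: prod_eq_iff)
  then have "\<forall>\<^sub>F w in at z. K w - (K z - G z) = G w"
    by (simp add: eventually_at_filter eventually_mono)
  moreover have "((\<lambda>w. K w - (K z - G z)) has_derivative B) (at z)"
    using has_derivative_diff[OF K_deriv has_derivative_const[of "K z - G z"]] by simp
  ultimately have "(G has_derivative B) (at z)"
    using has_derivative_transform_eventually by fastforce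
  with z(2) show ?thesis
    by (rule has_derivative_unique)
qed

lemma torus_deriv_lift:
  assumes "\<And>w. F (torus_proj w) = torus_proj (G w)" "(G has_derivative A) (at z)"
  shows "torus_deriv F (torus_proj z) = A"
proof -
  have "has_torus_derivative F A (torus_proj z)"
    unfolding has_torus_derivative_def using assms by (intro exI[of _ z] exI[of _ G]) simp
  then show ?thesis
    unfolding torus_deriv_def using has_torus_derivative_unique by blast
qed

section \<open>Derivatives of iterates and exponential contraction\<close>

primrec tangent_iterate ::
    "('a \<Rightarrow> 'a) \<Rightarrow> ('a \<Rightarrow> 'b \<Rightarrow> 'b) \<Rightarrow> 'a \<Rightarrow> nat \<Rightarrow> 'b \<Rightarrow> 'b" where
  "tangent_iterate G D z 0 v = v"
| "tangent_iterate G D z (Suc n) v = D ((G ^^ n) z) (tangent_iterate G D z n v)"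

lemma funpow_has_derivative:
  assumes "\<And>w. (G has_derivative D w) (at w)"
  shows "((G ^^ n) has_derivative tangent_iterate G D z n) (at z)"
proof (induction n)
  case 0
  have "tangent_iterate G D z 0 = (\<lambda>v. v)"
    by auto
  then show ?case
    by (simp add: id_def)
next
  case (Suc n)
  have "tangent_iterate G D z (Suc n) = D ((G ^^ n) z) \<circ> tangent_iterate G D z n"
    by auto
  then show ?case
    using diff_chain_at[OF Suc assms] by (simp only: funpow.simps)
qed

lemma torus_deriv_funpow:
  assumes "\<And>w. F (torus_proj w) = torus_proj (G w)" "\<And>w. (G has_derivative D w) (at w)"
  shows "torus_deriv (F ^^ n) (torus_proj z) = tangent_iterate G D z n"
proof (rule torus_deriv_lift)
  show "(F ^^ n) (torus_proj w) = torus_proj ((G ^^ n) w)" for w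
    using assms(1) by (induction n) auto
qed (rule funpow_has_derivative[OF assms(2)])

lemma norm_tendsto_0_of_log_rate:
  fixes f :: "nat \<Rightarrow> 'a::real_normed_vector"
  assumes "(\<lambda>n. ln (norm (f n)) / real n) \<longlonglongrightarrow> - \<kappa>" "0 < \<kappa>"
  shows "f \<longlonglongrightarrow> 0"
proof (rule Lim_null_comparison)
  have "\<forall>\<^sub>F n in sequentially. ln (norm (f n)) / real n < - \<kappa> / 2"
    using assms by (intro order_tendstoD(2)[OF assms(1)]) simp
  with eventually_gt_at_top[of 0]
  show "\<forall>\<^sub>F n in sequentially. norm (f n) \<le> exp (- \<kappa> / 2) ^ n"
  proof eventually_elim
    case (elim n)
    then have l: "ln (norm (f n)) < real n * (- \<kappa> / 2)"
      by (simp add: field_simps)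
    \<comment> \<open>An inequality also covers \<open>f n = 0\<close>, where the logarithm has a
      default value.\<close>
    have "norm (f n) \<le> exp (ln (norm (f n)))"
      by (cases "f n = 0") auto
    also have "\<dots> \<le> exp (real n * (- \<kappa> / 2))"
      using l by simp
    finally show ?case
      by (simp only: exp_of_nat_mult)
  qed
  show "(\<lambda>n. exp (- \<kappa> / 2) ^ n) \<longlonglongrightarrow> 0"
    using assms(2) by (intro LIMSEQ_power_zero) simp
qed

section \<open>From the circle map to its lift\<close>

text \<open>Taylor expansion at 0 with remainder in the third derivative gives the upper bounds and
  the lower bound near 0; compactness and positivity of the derivative give the lower bound
  elsewhere.\<close>

lemma cubic_lift_exists:
  fixes h :: "circle \<Rightarrow> circle"
  assumes "circle_smooth h" and h0: "h 0 = 0"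
    and d1: "circle_deriv 1 h 0 = 0"
    and pos: "\<And>x. x \<noteq> 0 \<Longrightarrow> circle_deriv 1 h x > 0"
    and d3: "circle_deriv 3 h 0 > 0"
  obtains H g M \<beta> where "cubic_lift H g M \<beta>" "\<And>x. h (proj x) = proj (H x)"
proof -
  define L where "L = (SOME H. smooth_lift H h)"
  have L: "smooth_lift L h"
    using assms(1) unfolding circle_smooth_def L_def by (rule someI_ex)
  define g1 where "g1 = deriv L"
  define g2 where "g2 = deriv g1"
  define g3 where "g3 = deriv g2"
  define H where "H x = L x - L 0" for x
  have iter: "(deriv ^^ 1) L = g1" "(deriv ^^ 2) L = g2" "(deriv ^^ 3) L = g3"
    by (simp_all add: g1_def g2_def g3_def numeral_2_eq_2 numeral_3_eq_3)
  have diffble: "(deriv ^^ k) L differentiable (at x)" for k x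
    using L by (simp add: smooth_lift_def)
  have L_deriv: "(L has_real_derivative g1 x) (at x)" for x
    using diffble[of 0 x] by (simp add: g1_def DERIV_deriv_iff_real_differentiable)
  have H_deriv: "(H has_real_derivative g1 x) (at x)" for x
    unfolding H_def[abs_def] by (auto intro!: derivative_eq_intros L_deriv)
  have g1_deriv: "(g1 has_real_derivative g2 x) (at x)" for x
    using diffble[of 1 x] unfolding iter by (simp add: g2_def DERIV_deriv_iff_real_differentiable)
  have g2_deriv: "(g2 has_real_derivative g3 x) (at x)" for x
    using diffble[of 2 x] unfolding iter by (simp add: g3_def DERIV_deriv_iff_real_differentiable)
  have g3_cont: "isCont g3 x" for x
    using diffble[of 3 x] unfolding iter by (simp add: differentiable_imp_continuous_within)
  have coord_g1: "circle_deriv 1 h a = g1 (coord a)" and coord_g3: "circle_deriv 3 h a = g3 (coord a)" for a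
    by (simp_all add: circle_deriv_def iter flip: L_def del: One_nat_def)

  have lift_L: "h (proj x) = proj (L x)" for x
    using L by (simp add: smooth_lift_def)
  have "proj (L 0) = 0"
    using lift_L[of 0] h0 by (simp add: proj_0)
  then have lift_H: "h (proj x) = proj (H x)" for x
    by (simp add: H_def proj_diff lift_L)
  have H_shift: "H (x + of_int m) - H x \<in> \<int>" for x m
    using lift_H[of x] lift_H[of "x + of_int m"] by (simp flip: proj_eq_iff)
  have g_shift: "g1 (x + of_int m) = g1 x" for x m
  proof -
    \<comment> \<open>Integer valued and continuous, hence locally constant, so its derivative is
      0.\<close>
    define f where "f w = H (w + of_int m) - H w" for w
    have f_deriv: "(f has_real_derivative g1 (x + of_int m) - g1 x) (at x)"
      unfolding f_def[abs_def]
      by (rule DERIV_diff) (use H_deriv DERIV_shift in blast)+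
    then have "\<forall>\<^sub>F w in nhds x. f w = f x"
      by (intro integer_valued_locally_constant DERIV_isCont[OF f_deriv]) (auto simp: f_def H_shift)
    then have "(f has_real_derivative 0) (at x)"
      using DERIV_cong_ev[of x x f "\<lambda>_. f x" 0 0] by simp
    then show ?thesis
      using DERIV_unique[OF f_deriv, of 0] by simp
  qed

  have coord_0: "coord 0 = 0"
    using coord_proj[of 0] by (simp add: proj_0)
  have g1_0: "g1 0 = 0" and g3_0: "0 < g3 0"
    using d1 d3 by (simp_all add: coord_g1 coord_g3 coord_0 del: One_nat_def)
  have g1_pos': "0 < g1 x" if "- 1/2 < x" "x \<le> 1/2" "x \<noteq> 0" for x
  proof -
    have "proj x \<noteq> 0"
      using coord_proj[OF that(1,2)] that(3) coord_0 by auto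
    then show ?thesis
      using pos[of "proj x"] coord_proj[OF that(1,2)] by (simp add: coord_g1 del: One_nat_def)
  qed
  have g1_pos: "0 < g1 x" if "\<bar>x\<bar> \<le> 1/2" "x \<noteq> 0" for x
  \<comment> \<open>The left endpoint is not a value of \<open>coord\<close>; periodicity reduces it
    to \<open>1/2\<close>.\<close>
  proof (cases "x = - 1/2")
    case True
    then show ?thesis
      using g_shift[of "- 1/2" 1] g1_pos'[of "1/2"] by simp
  qed (use that g1_pos'[of x] in auto)
  \<comment> \<open>The derivative \<open>g1\<close> has a local minimum at 0, which removes the
    quadratic term of \<open>H\<close>.\<close>
  have g2_0: "g2 0 = 0"
  proof (rule DERIV_local_min[OF g1_deriv])
    show "\<forall>y. \<bar>0 - y\<bar> < 1/2 \<longrightarrow> g1 0 \<le> g1 y"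
      using g1_pos g1_0 by (metis abs_minus_commute diff_zero less_eq_real_def)
  qed simp

  have H_Taylor: "\<exists>t. \<bar>t\<bar> \<le> \<bar>x\<bar> \<and> H x = g3 t / 6 * x ^ 3" for x
  proof -
    define D where "D m = (if m = 0 then H else if m = 1 then g1 else if m = 2 then g2 else g3)" for m :: nat
    have "\<exists>t. \<bar>t\<bar> \<le> \<bar>x\<bar> \<and> H x = (\<Sum>m<3. D m 0 / fact m * x ^ m) + D 3 t / fact 3 * x ^ 3"
    proof (rule Maclaurin_bi_le)
      show "\<forall>m t. m < 3 \<and> \<bar>t\<bar> \<le> \<bar>x\<bar> \<longrightarrow> DERIV (D m) t :> D (Suc m) t"
        using H_deriv g1_deriv g2_deriv by (auto simp: D_def numeral_3_eq_3 less_Suc_eq)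
    qed (simp add: D_def)
    then show ?thesis
      by (simp add: D_def numeral_3_eq_3 g1_0 g2_0) (simp add: H_def fact_numeral)
  qed
  have g_Taylor: "\<exists>t. \<bar>t\<bar> \<le> \<bar>x\<bar> \<and> g1 x = g3 t / 2 * x\<^sup>2" for x
  proof -
    define D where "D m = (if m = 0 then g1 else if m = 1 then g2 else g3)" for m :: nat
    have "\<exists>t. \<bar>t\<bar> \<le> \<bar>x\<bar> \<and> g1 x = (\<Sum>m<2. D m 0 / fact m * x ^ m) + D 2 t / fact 2 * x ^ 2"
    proof (rule Maclaurin_bi_le)
      show "\<forall>m t. m < 2 \<and> \<bar>t\<bar> \<le> \<bar>x\<bar> \<longrightarrow> DERIV (D m) t :> D (Suc m) t"
        using g1_deriv g2_deriv by (auto simp: D_def numeral_2_eq_2 less_Suc_eq)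
    qed (simp add: D_def)
    then show ?thesis
      by (simp add: D_def numeral_2_eq_2 g1_0 g2_0)
  qed

  have "bounded (g3 ` {-1..1})"
    using g3_cont by (intro compact_imp_bounded compact_continuous_image)
      (auto simp: continuous_at_imp_continuous_on)
  then obtain M0 where "\<forall>y \<in> g3 ` {-1..1}. norm y \<le> M0"
    unfolding bounded_iff by blast
  then have M0: "\<bar>g3 t\<bar> \<le> M0" if "\<bar>t\<bar> \<le> 1" for t
    using that by (simp add: abs_le_iff)
  define M where "M = max 1 M0"
  have M: "\<bar>g3 t\<bar> \<le> M" if "\<bar>t\<bar> \<le> 1" for t
    using M0[OF that] by (simp add: M_def)
  have H_upper: "\<bar>H x\<bar> \<le> M * \<bar>x\<bar> ^ 3" if x: "\<bar>x\<bar> \<le> 1" for x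
  proof -
    obtain t where t: "\<bar>t\<bar> \<le> \<bar>x\<bar>" "H x = g3 t / 6 * x ^ 3"
      using H_Taylor by blast
    have "\<bar>H x\<bar> = \<bar>g3 t\<bar> / 6 * \<bar>x\<bar> ^ 3"
      by (simp add: t(2) abs_mult power_abs)
    also have "\<dots> \<le> M * \<bar>x\<bar> ^ 3"
      using M[of t] t(1) x by (intro mult_right_mono) auto
    finally show ?thesis .
  qed
  have g_upper: "g1 x \<le> M * x\<^sup>2" if x: "\<bar>x\<bar> \<le> 1" for x
  proof -
    obtain t where t: "\<bar>t\<bar> \<le> \<bar>x\<bar>" "g1 x = g3 t / 2 * x\<^sup>2"
      using g_Taylor by blast
    show ?thesis
      unfolding t(2) using M[of t] t(1) x by (intro mult_right_mono) auto
  qed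

  have "\<forall>\<^sub>F t in nhds 0. g3 0 / 2 < g3 t"
    using g3_cont[of 0] g3_0 by (intro order_tendstoD(1)[of _ "g3 0"])
      (auto simp: isCont_def tendsto_at_iff_tendsto_nhds)
  then obtain r0 where r0: "r0 > 0" "\<And>t. \<bar>t\<bar> < r0 \<Longrightarrow> g3 0 / 2 < g3 t"
    by (auto simp: eventually_nhds_metric dist_real_def)
  define r where "r = min r0 (1/2)"
  have r: "0 < r" "r \<le> 1/2"
    using r0 by (auto simp: r_def)
  define K where "K = {-1/2..1/2} - {-r<..<r}"
  have "compact K"
    unfolding K_def by (intro compact_diff) auto
  moreover have "1/2 \<in> K"
    using r by (simp add: K_def)
  moreover have "continuous_on K g1"
    using g1_deriv DERIV_isCont by (blast intro: continuous_at_imp_continuous_on)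
  ultimately obtain y where y: "y \<in> K" "\<And>x. x \<in> K \<Longrightarrow> g1 y \<le> g1 x"
    using continuous_attains_inf[of K g1] by auto
  have g1_y: "0 < g1 y"
    using y(1) r by (intro g1_pos) (auto simp: K_def)
  \<comment> \<open>Near 0 the Taylor coefficient \<open>g3 t / 2\<close> exceeds
    \<open>g3 0 / 4\<close>; on \<open>K\<close> the minimum \<open>g1 y\<close> suffices because
    \<open>x\<^sup>2 \<le> 1\<close>.\<close>
  define \<beta> where "\<beta> = min 1 (min (g3 0 / 4) (g1 y))"
  have \<beta>: "0 < \<beta>" "\<beta> \<le> 1"
    using g3_0 g1_y by (auto simp: \<beta>_def)
  have g_lower: "\<beta> * x\<^sup>2 \<le> g1 x" if x: "\<bar>x\<bar> \<le> 1/2" for x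
  proof (cases "\<bar>x\<bar> < r")
    case True
    obtain t where t: "\<bar>t\<bar> \<le> \<bar>x\<bar>" "g1 x = g3 t / 2 * x\<^sup>2"
      using g_Taylor by blast
    have "g3 0 / 2 < g3 t"
      using r0(2)[of t] t(1) True by (simp add: r_def)
    then have "\<beta> \<le> g3 t / 2"
      by (simp add: \<beta>_def min_le_iff_disj)
    then show ?thesis
      unfolding t(2) by (rule mult_right_mono) simp
  next
    case False
    then have "x \<in> K"
      using x by (auto simp: K_def)
    then have "g1 y \<le> g1 x"
      by (rule y(2))
    moreover have "\<beta> * x\<^sup>2 \<le> g1 y * 1"
      using x g1_y by (intro mult_mono) (auto simp: \<beta>_def abs_square_le_1)
    ultimately show ?thesis by simp
  qed
  have "cubic_lift H g1 M \<beta>"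
    using H_deriv H_shift g_shift H_upper g_upper g_lower \<beta> by unfold_locales (auto simp: M_def)
  then show thesis
    using lift_H that by blast
qed


section \<open>Unstable and stable directions\<close>

context cubic_lift
begin

definition T_lift :: "real \<times> real \<Rightarrow> real \<times> real" where
  "T_lift z = (fst z + H (fst z) + snd z, H (fst z) + snd z)"
definition D_T :: "real \<times> real \<Rightarrow> real \<times> real \<Rightarrow> real \<times> real" where
  "D_T z v = (fst v + g (fst z) * fst v + snd v, g (fst z) * fst v + snd v)"
definition S_lift :: "real \<times> real \<Rightarrow> real \<times> real" where
  "S_lift z = (fst z - snd z, snd z - H (fst z - snd z))"
definition D_S :: "real \<times> real \<Rightarrow> real \<times> real \<Rightarrow> real \<times> real" where
  "D_S z v = (fst v - snd v, snd v - g (fst z - snd z) * (fst v - snd v))"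
definition Pi_lift :: "real \<times> real \<Rightarrow> real \<times> real" where
  "Pi_lift z = (fst z, - snd z - H (fst z))"
definition D_Pi :: "real \<times> real \<Rightarrow> real \<times> real \<Rightarrow> real \<times> real" where
  "D_Pi z v = (fst v, - snd v - g (fst z) * fst v)"

lemma H_has_derivative_compose:
  assumes "(f has_derivative f') (at z)"
  shows "((\<lambda>w. H (f w)) has_derivative (\<lambda>v. g (f z) * f' v)) (at z)"
  using has_derivative_compose[OF assms, of H "\<lambda>t. g (f z) * t"] H_deriv[of "f z"]
  by (simp add: has_field_derivative_def)

lemma T_lift_deriv: "(T_lift has_derivative D_T z) (at z)"
  unfolding T_lift_def[abs_def] D_T_def[abs_def]
  by (auto intro!: derivative_eq_intros H_has_derivative_compose)

lemma S_lift_deriv: "(S_lift has_derivative D_S z) (at z)"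
  unfolding S_lift_def[abs_def] D_S_def[abs_def]
  by (auto intro!: derivative_eq_intros H_has_derivative_compose)

lemma Pi_lift_deriv: "(Pi_lift has_derivative D_Pi z) (at z)"
  unfolding Pi_lift_def[abs_def] D_Pi_def[abs_def]
  by (auto intro!: derivative_eq_intros H_has_derivative_compose)

text \<open>Reversibility of the map, holding exactly for the lifts and not only modulo 1.\<close>

lemma Pi_lift_conj: "S_lift (Pi_lift z) = Pi_lift (T_lift z)"
  by (simp add: S_lift_def Pi_lift_def T_lift_def algebra_simps)

lemma D_Pi_conj: "D_S (Pi_lift z) (D_Pi z v) = D_Pi (T_lift z) (D_T z v)"
  by (simp add: D_S_def D_Pi_def D_T_def Pi_lift_def T_lift_def algebra_simps)

lemma D_Pi_invol: "D_Pi (Pi_lift z) (D_Pi z v) = v"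
  by (simp add: D_Pi_def Pi_lift_def)

lemma D_Pi_scaleR: "D_Pi z (c *\<^sub>R v) = c *\<^sub>R D_Pi z v"
  by (simp add: D_Pi_def algebra_simps)

text \<open>The abstract sequences become iterates of \<open>S_lift\<close> and \<open>D_S\<close>;
  the scalar \<open>c\<close> is the first component of \<open>v\<close>, which cannot
  vanish.\<close>

lemma contracted_vector_in_cone:
  assumes z: "\<bar>fst z\<bar> \<le> 1 / 2" "\<bar>snd z\<bar> \<le> 1 / 2" and "v \<noteq> 0"
    and lim: "(\<lambda>n. tangent_iterate S_lift D_S z n v) \<longlonglongrightarrow> 0"
  obtains c u where "c \<noteq> 0" "v = c *\<^sub>R (1, u)"
    "K_lower * (\<bar>fst z\<bar> + sqrt \<bar>snd z\<bar>) \<le> u" "u \<le> K_upper * (\<bar>fst z\<bar> + sqrt \<bar>snd z\<bar>)"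
proof -
  define X Y where "X n = fst ((S_lift ^^ n) z)" and "Y n = snd ((S_lift ^^ n) z)" for n
  define a b where "a n = fst (tangent_iterate S_lift D_S z n v)"
    and "b n = snd (tangent_iterate S_lift D_S z n v)" for n
  interpret contracted_vector H g M \<beta> X Y a b
  proof
    show "a \<longlonglongrightarrow> 0" "b \<longlonglongrightarrow> 0"
      using tendsto_fst[OF lim] tendsto_snd[OF lim] by (simp_all add: a_def[abs_def] b_def[abs_def])
    show "a 0 \<noteq> 0 \<or> b 0 \<noteq> 0"
      using \<open>v \<noteq> 0\<close> by (auto simp: a_def b_def prod_eq_iff)
  qed (use z in \<open>simp_all add: X_def Y_def a_def b_def S_lift_def D_S_def\<close>)
  have "v = a 0 *\<^sub>R (1, slope 0)"
    using a_nonzero[of 0] by (simp add: slope_def a_def b_def prod_eq_iff)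
  moreover have "\<rho> = \<bar>fst z\<bar> + sqrt \<bar>snd z\<bar>"
    by (simp add: \<rho>_def X_def Y_def)
  ultimately show ?thesis
    using that[of "a 0" "slope 0"] a_nonzero[of 0] slope_bounds by simp
qed

end

lemma span_singleton_scaleR:
  assumes "c \<noteq> 0" "v = c *\<^sub>R w"
  shows "span {v} = span {w}"
proof -
  have "w = (1 / c) *\<^sub>R v"
    using assms by simp
  then have "w \<in> span {v}"
    by (metis insertI1 span_base span_scale)
  moreover have "v \<in> span {w}"
    using assms by (metis insertI1 span_base span_scale)
  ultimately show ?thesis
    by (simp add: span_eq)
qed

lemma dim_1_eq_span:
  fixes E :: "'a::euclidean_space set"
  assumes "subspace E" "dim E = 1"
  obtains v where "v \<in> E" "v \<noteq> 0" "E = span {v}"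
proof -
  obtain B where B: "B \<subseteq> E" "independent B" "E \<subseteq> span B" "card B = dim E"
    using basis_exists by blast
  then obtain v where v: "B = {v}"
    using assms(2) card_1_singletonE[of B] by auto
  have "v \<in> E" "v \<noteq> 0"
    using B(1,2) dependent_zero[of B] unfolding v by auto
  moreover have "E = span {v}"
    using B(3) span_minimal[OF B(1) assms(1)] unfolding v by (rule subset_antisym)
  ultimately show ?thesis
    by (rule that)
qed

section \<open>Unstable and stable lines on the torus\<close>

locale lifted_torus_map = cubic_lift +
  fixes h :: "circle \<Rightarrow> circle"
  assumes lift: "h (proj x) = proj (H x)"
begin

lemma T_lift_proj: "T_map h (torus_proj w) = torus_proj (T_lift w)"
  by (cases w) (simp add: T_map_def T_lift_def lift proj_add)

lemma inv_T: "inv (T_map h) = (\<lambda>(x, y). (x - y, y - h (x - y)))"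
  by (rule inv_unique_comp) (auto simp: T_map_def fun_eq_iff algebra_simps)

lemma S_lift_proj: "inv (T_map h) (torus_proj w) = torus_proj (S_lift w)"
  by (cases w) (simp add: inv_T S_lift_def lift proj_diff flip: proj_diff)

lemma Pi_lift_proj: "Pi_map h (torus_proj w) = torus_proj (Pi_lift w)"
  by (cases w) (simp add: Pi_map_def Pi_lift_def lift proj_diff proj_minus)

definition rep :: "torus \<Rightarrow> real \<times> real" where
  "rep \<xi> = (coord (fst \<xi>), coord (snd \<xi>))"

lemma torus_proj_rep: "torus_proj (rep \<xi>) = \<xi>"
  by (simp add: rep_def)

lemma cone_plusI:
  assumes "Kl * (\<bar>fst (rep \<xi>)\<bar> + sqrt \<bar>snd (rep \<xi>)\<bar>) \<le> u"
    "u \<le> Ku * (\<bar>fst (rep \<xi>)\<bar> + sqrt \<bar>snd (rep \<xi>)\<bar>)"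
  shows "(1, u) \<in> cone_plus Kl Ku \<xi>"
  using assms by (cases \<xi>) (simp add: cone_plus_def rep_def)

lemma rep_bounds: "\<bar>fst (rep \<xi>)\<bar> \<le> 1 / 2" "\<bar>snd (rep \<xi>)\<bar> \<le> 1 / 2"
  using abs_coord_le by (simp_all add: rep_def)

lemma unstable_direction_in_cone:
  assumes "is_unstable_direction (T_map h) \<xi> E"
  shows "line_belongs E (cone_plus K_lower K_upper \<xi>)"
proof -
  obtain \<kappa> where \<kappa>: "0 < \<kappa>" "E = oseledets_space (T_map h) \<xi> \<kappa>" "subspace E" "dim E = 1"
    using assms unfolding is_unstable_direction_def by blast
  obtain v where v: "v \<in> E" "v \<noteq> 0" "E = span {v}"
    using dim_1_eq_span[OF \<kappa>(3,4)] by blast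
  have "has_lyapunov_exponent (T_map h) \<xi> v \<kappa>"
    using v(1,2) \<kappa>(2) by (simp add: oseledets_space_def)
  then have "(\<lambda>n. torus_deriv (inv (T_map h) ^^ n) \<xi> v) \<longlonglongrightarrow> 0"
    using \<kappa>(1) unfolding has_lyapunov_exponent_def
    by (intro norm_tendsto_0_of_log_rate[of _ \<kappa>]) auto
  then have "(\<lambda>n. tangent_iterate S_lift D_S (rep \<xi>) n v) \<longlonglongrightarrow> 0"
    using torus_deriv_funpow[OF S_lift_proj S_lift_deriv, of _ "rep \<xi>"] by (simp add: torus_proj_rep)
  then obtain c u where cu: "c \<noteq> 0" "v = c *\<^sub>R (1, u)"
    "K_lower * (\<bar>fst (rep \<xi>)\<bar> + sqrt \<bar>snd (rep \<xi>)\<bar>) \<le> u"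
    "u \<le> K_upper * (\<bar>fst (rep \<xi>)\<bar> + sqrt \<bar>snd (rep \<xi>)\<bar>)"
    by (rule contracted_vector_in_cone[OF rep_bounds v(2)])
  from v(3) span_singleton_scaleR[OF cu(1,2)] have "E = span {(1, u)}"
    by (rule trans)
  then show ?thesis
    unfolding line_belongs_def by (intro bexI[of _ "(1, u)"] cone_plusI[OF cu(3,4)])
qed

text \<open>The derivative of the involution carries the forward orbit of a stable vector at \<xi>
  to the backward orbit of a vector at \<open>Pi_map h \<xi>\<close>, which is again
  contracted.\<close>

lemma stable_direction_in_cone:
  assumes "is_stable_direction (T_map h) \<xi> E"
  shows "line_belongs E (cone_minus h K_lower K_upper \<xi>)"
proof -
  obtain \<kappa> where \<kappa>: "\<kappa> < 0" "E = oseledets_space (T_map h) \<xi> \<kappa>" "subspace E" "dim E = 1"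
    using assms unfolding is_stable_direction_def by blast
  obtain v where v: "v \<in> E" "v \<noteq> 0" "E = span {v}"
    using dim_1_eq_span[OF \<kappa>(3,4)] by blast
  have "has_lyapunov_exponent (T_map h) \<xi> v \<kappa>"
    using v(1,2) \<kappa>(2) by (simp add: oseledets_space_def)
  then have T_lim: "(\<lambda>n. torus_deriv (T_map h ^^ n) \<xi> v) \<longlonglongrightarrow> 0"
    using \<kappa>(1) unfolding has_lyapunov_exponent_def
    by (intro norm_tendsto_0_of_log_rate[of _ "- \<kappa>"]) auto
  define \<zeta> where "\<zeta> = Pi_map h \<xi>"
  \<comment> \<open>This representative of \<xi> is used instead of \<open>rep \<xi>\<close> so that
    its image under \<open>Pi_lift\<close> is exactly \<open>rep \<zeta>\<close>, a point of the
    fundamental square.\<close>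
  define z where "z = Pi_lift (rep \<zeta>)"
  have rep_\<zeta>: "rep \<zeta> = Pi_lift z"
    by (simp add: z_def Pi_lift_def)
  have "torus_proj z = Pi_map h (Pi_map h \<xi>)"
    by (simp add: z_def torus_proj_rep \<zeta>_def flip: Pi_lift_proj)
  also have "\<dots> = \<xi>"
    by (cases \<xi>) (simp add: Pi_map_def)
  finally have z: "torus_proj z = \<xi>" .
  define t where "t n = tangent_iterate T_lift D_T z n v" for n
  define w where "w n = D_Pi ((T_lift ^^ n) z) (t n)" for n
  have t_lim: "t \<longlonglongrightarrow> 0"
    using T_lim torus_deriv_funpow[OF T_lift_proj T_lift_deriv, of _ z] by (simp add: z t_def[abs_def])
  \<comment> \<open>The conjugacy of vectors needs that of their base points, so the induction
    carries both.\<close>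
  have "tangent_iterate S_lift D_S (rep \<zeta>) n (w 0) = w n
      \<and> (S_lift ^^ n) (rep \<zeta>) = Pi_lift ((T_lift ^^ n) z)" for n
    by (induction n) (auto simp: rep_\<zeta> w_def t_def Pi_lift_conj D_Pi_conj)
  moreover have "w \<longlonglongrightarrow> 0"
  proof -
    have fst_lim: "(\<lambda>n. fst (t n)) \<longlonglongrightarrow> 0" and snd_lim: "(\<lambda>n. snd (t n)) \<longlonglongrightarrow> 0"
      using tendsto_fst[OF t_lim] tendsto_snd[OF t_lim] by simp_all
    \<comment> \<open>The base point varies with \<open>n\<close>; the uniform bound
      \<open>g_le\<close> keeps \<open>D_Pi\<close> bounded along the orbit.\<close>
    have "(\<lambda>n. g (fst ((T_lift ^^ n) z)) * fst (t n)) \<longlonglongrightarrow> 0"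
    proof (rule Lim_null_comparison)
      show "\<forall>\<^sub>F n in sequentially. norm (g (fst ((T_lift ^^ n) z)) * fst (t n)) \<le> M * \<bar>fst (t n)\<bar>"
        using g_nonneg g_le by (auto simp: abs_mult intro!: always_eventually mult_right_mono)
      show "(\<lambda>n. M * \<bar>fst (t n)\<bar>) \<longlonglongrightarrow> 0"
        using tendsto_mult_right_zero[OF tendsto_rabs_zero[OF fst_lim]] by simp
    qed
    then have "(\<lambda>n. - snd (t n) - g (fst ((T_lift ^^ n) z)) * fst (t n)) \<longlonglongrightarrow> - 0 - 0"
      using snd_lim by (intro tendsto_intros)
    then have "w \<longlonglongrightarrow> (0, - 0 - 0)"
      unfolding w_def[abs_def] D_Pi_def using fst_lim by (intro tendsto_Pair)
    then show ?thesis
      by (simp add: zero_prod_def)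
  qed
  ultimately have w_lim: "(\<lambda>n. tangent_iterate S_lift D_S (rep \<zeta>) n (w 0)) \<longlonglongrightarrow> 0"
    by simp
  have w0: "D_Pi (rep \<zeta>) (w 0) = v"
    by (simp add: w_def t_def rep_\<zeta> D_Pi_invol)
  have "w 0 \<noteq> 0"
    using w0 v(2) by (auto simp: D_Pi_def zero_prod_def)
  then obtain c u where cu: "c \<noteq> 0" "w 0 = c *\<^sub>R (1, u)"
    "K_lower * (\<bar>fst (rep \<zeta>)\<bar> + sqrt \<bar>snd (rep \<zeta>)\<bar>) \<le> u"
    "u \<le> K_upper * (\<bar>fst (rep \<zeta>)\<bar> + sqrt \<bar>snd (rep \<zeta>)\<bar>)"
    by (rule contracted_vector_in_cone[OF rep_bounds _ w_lim])
  have "v = c *\<^sub>R D_Pi (rep \<zeta>) (1, u)"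
    using w0 cu(2) D_Pi_scaleR by metis
  from v(3) span_singleton_scaleR[OF cu(1) this] have "E = span {D_Pi (rep \<zeta>) (1, u)}"
    by (rule trans)
  moreover have "torus_deriv (Pi_map h) \<zeta> = D_Pi (rep \<zeta>)"
    using torus_deriv_lift[of "Pi_map h" Pi_lift, OF Pi_lift_proj Pi_lift_deriv, of "rep \<zeta>"]
    by (simp add: torus_proj_rep)
  then have "D_Pi (rep \<zeta>) (1, u) \<in> cone_minus h K_lower K_upper \<xi>"
    using cone_plusI[OF cu(3,4)] unfolding cone_minus_def \<zeta>_def[symmetric] by (metis imageI)
  ultimately show ?thesis
    unfolding line_belongs_def by (intro bexI[of _ "D_Pi (rep \<zeta>) (1, u)"])
qed

end

theorem proposition4p1:
  fixes h :: "circle \<Rightarrow> circle"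
  assumes "circle_smooth h"
    and "h 0 = 0"
    and "circle_deriv 1 h 0 = 0"
    and "\<And>x. x \<noteq> 0 \<Longrightarrow> circle_deriv 1 h x > 0"
    and "circle_deriv 3 h 0 > 0"
    and "\<And>x. h (- x) = - h x"
  shows "\<exists>Kplus>0. \<exists>Kminus>0. \<forall>\<xi>.
    (\<forall>E. is_unstable_direction (T_map h) \<xi> E \<longrightarrow>
      line_belongs E (cone_plus Kminus Kplus \<xi>)) \<and>
    (\<forall>E. is_stable_direction (T_map h) \<xi> E \<longrightarrow>
      line_belongs E (cone_minus h Kminus Kplus \<xi>))"
proof -
  obtain H g M \<beta> where lift: "cubic_lift H g M \<beta>" "\<And>x. h (proj x) = proj (H x)"
    using cubic_lift_exists[OF assms(1-5)] by blast
  interpret lifted_torus_map H g M \<beta> h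
    using lift by (simp add: lifted_torus_map_def lifted_torus_map_axioms_def)
  show ?thesis
    using K_upper_pos K_lower_pos unstable_direction_in_cone stable_direction_in_cone by blast
qed

end
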